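(* Let $n,m\ge1$, let $W:\mathbb{R}^m\to\mathbb{R}$ satisfy hypothesis (HA) at $a\in\mathbb{R}^m$, and let $u:\mathbb{R}^n\to\mathbb{R}^m$ be minimal in the sense of hypothesis (HB) with $D=\mathbb{R}^n$. Let $\mathcal{Z}=\{W=0\}\setminus\{a\}$ and assume that either $\mathcal{Z}=\emptyset$ or $\inf_{x\in\mathbb{R}^n}d(u(x),\mathcal{Z})>0$, where $d$ is the Euclidean distance. Then $u\equiv a$.
   Context: $W_u$ is the gradient and $W_{uu}$ the Hessian matrix of $W$; $\cdot$ is the Euclidean inner product. Hypothesis (HA) at $a$: $W:\mathbb{R}^m\to\mathbb{R}$ is nonnegative, $W(a)=0$, and for some $\alpha\in(0,2]$, $W\in C^\alpha(\mathbb{R}^m;\mathbb{R})\cap C^1(\mathbb{R}^m\setminus\{a\};\mathbb{R})$ (here $C^\alpha$ means locally Hölder of exponent $\alpha$ if $0<\alpha<1$, locally Lipschitz if $\alpha=1$, $C^{1,\alpha-1}$ locally if $1<\alpha<2$, and $C^2$ if $\alpha=2$). If $0<\alpha<2$, there are constants $C^*>0$, $\rho_0>0$ with $W_u(a+\rho\nu)\cdot\nu\ge C^*\rho^{\alpha-1}$ for $0<\rho\le\rho_0$, $|\nu|=1$. If $\alpha=2$, there is a constant $C_0>0$ with $W_{uu}(a)\nu\cdot\nu\ge C_0$ for $|\nu|=1$. Hypothesis (HB) (for an open $D\subset\mathbb{R}^n$): $u\in W^{1,2}_{\rm loc}(D;\mathbb{R}^m)\cap L^\infty(D;\mathbb{R}^m)$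 is minimal, i.e. for every open bounded set $\Omega\subset D$ and every $v\in W^{1,2}_0(\Omega;\mathbb{R}^m)$ one has $J_\Omega(u)\le J_\Omega(u+v)$, where $J_\Omega(u)=\int_\Omega\big(\frac12|\nabla u|^2+W(u)\big)dx$; moreover, for some constant $M>0$, $|u-a|<M$ and $|\nabla u|<M$ on $D$. *)

theory Defs
  imports "HOL-Analysis.Analysis"
begin

section \<open>Gradient, Hessian, regularity classes\<close>

text \<open>Only meaningful where \<open>f\<close> is differentiable; the vector is then unique.\<close>

definition grad :: "('a::real_inner \<Rightarrow> real) \<Rightarrow> 'a \<Rightarrow> 'a" where
  "grad f x = (THE D. GDERIV f x :> D)"

definition hessian :: "(real^'m \<Rightarrow> real) \<Rightarrow> real^'m \<Rightarrow> real^'m^'m" where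
  "hessian f x = jacobian (grad f) (at x)"

text \<open>Intended for open \<open>S\<close>.\<close>

definition C1_on :: "'a::real_normed_vector set \<Rightarrow> ('a \<Rightarrow> 'b::real_normed_vector) \<Rightarrow> bool" where
  "C1_on S f \<longleftrightarrow> (\<exists>f' :: 'a \<Rightarrow> ('a \<Rightarrow>\<^sub>L 'b).
     (\<forall>x\<in>S. (f has_derivative blinfun_apply (f' x)) (at x)) \<and> continuous_on S f')"

definition locally_hoelder ::
    "real \<Rightarrow> ('a::real_normed_vector \<Rightarrow> 'b::real_normed_vector) \<Rightarrow> bool" where
  "locally_hoelder \<gamma> f \<longleftrightarrow>
     (\<forall>x. \<exists>r>0. \<exists>L. \<forall>y\<in>ball x r. \<forall>z\<in>ball x r. norm (f y - f z) \<le> L * norm (y - z) powr \<gamma>)"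

text \<open>The class \<open>C\<^sup>\<alpha>\<close> on the whole space, for \<open>0 < \<alpha> \<le> 2\<close>.\<close>

definition C_alpha :: "real \<Rightarrow> (real^'m \<Rightarrow> real) \<Rightarrow> bool" where
  "C_alpha \<alpha> W \<longleftrightarrow>
     (\<alpha> < 1 \<longrightarrow> locally_hoelder \<alpha> W) \<and>
     (\<alpha> = 1 \<longrightarrow> (\<forall>x. \<exists>r>0. \<exists>L. L-lipschitz_on (ball x r) W)) \<and>
     (1 < \<alpha> \<and> \<alpha> < 2 \<longrightarrow> C1_on UNIV W \<and> locally_hoelder (\<alpha> - 1) (grad W)) \<and>
     (\<alpha> = 2 \<longrightarrow> C1_on UNIV W \<and> C1_on UNIV (grad W))"

definition HA :: "(real^'m \<Rightarrow> real) \<Rightarrow> real^'m \<Rightarrow> bool" where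
  "HA W a \<longleftrightarrow>
     (\<forall>z. 0 \<le> W z) \<and> W a = 0 \<and>
     (\<exists>\<alpha>. 0 < \<alpha> \<and> \<alpha> \<le> 2 \<and> C_alpha \<alpha> W \<and> C1_on (- {a}) W \<and>
       (\<alpha> < 2 \<longrightarrow> (\<exists>C>0. \<exists>\<rho>\<^sub>0>0. \<forall>\<rho> \<nu>. 0 < \<rho> \<and> \<rho> \<le> \<rho>\<^sub>0 \<and> norm \<nu> = 1 \<longrightarrow>
                     grad W (a + \<rho> *\<^sub>R \<nu>) \<bullet> \<nu> \<ge> C * \<rho> powr (\<alpha> - 1))) \<and>
       (\<alpha> = 2 \<longrightarrow> (\<exists>C\<^sub>0>0. \<forall>\<nu>. norm \<nu> = 1 \<longrightarrow> (hessian W a *v \<nu>) \<bullet> \<nu> \<ge> C\<^sub>0)))"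


section \<open>Sobolev spaces\<close>

text \<open>
  A Sobolev function on an open set is represented by a function on the whole space, of which
  only the values on that set, up to a null set, matter.  Test functions are \<open>C\<^sup>1\<close> with compact
  support, and the zero-trace space is the closure of these, as in Gilbarg and Trudinger,
  Sections 7.3 and 7.5.
\<close>

definition test_fun :: "(real^'n) set \<Rightarrow> (real^'n \<Rightarrow> 'b::real_normed_vector) \<Rightarrow> bool" where
  "test_fun \<Omega> \<phi> \<longleftrightarrow>
     C1_on UNIV \<phi> \<and> compact (closure {x. \<phi> x \<noteq> 0}) \<and> closure {x. \<phi> x \<noteq> 0} \<subseteq> \<Omega>"

definition L1_loc :: "(real^'n) set \<Rightarrow> (real^'n \<Rightarrow> 'b::euclidean_space) \<Rightarrow> bool" where
  "L1_loc \<Omega> f \<longleftrightarrow> (\<forall>K. compact K \<and> K \<subseteq> \<Omega> \<longrightarrow> f absolutely_integrable_on K)"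

definition L2 :: "(real^'n) set \<Rightarrow> (real^'n \<Rightarrow> 'b::euclidean_space) \<Rightarrow> bool" where
  "L2 \<Omega> f \<longleftrightarrow> f \<in> borel_measurable (lebesgue_on \<Omega>) \<and>
     integrable (lebesgue_on \<Omega>) (\<lambda>x. (norm (f x))\<^sup>2)"

definition L2_loc :: "(real^'n) set \<Rightarrow> (real^'n \<Rightarrow> 'b::euclidean_space) \<Rightarrow> bool" where
  "L2_loc \<Omega> f \<longleftrightarrow> (\<forall>K. compact K \<and> K \<subseteq> \<Omega> \<longrightarrow> L2 K f)"

definition Linfty :: "(real^'n) set \<Rightarrow> (real^'n \<Rightarrow> 'b::euclidean_space) \<Rightarrow> bool" where
  "Linfty \<Omega> f \<longleftrightarrow> f \<in> borel_measurable (lebesgue_on \<Omega>) \<and>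
     (\<exists>C. AE x in lebesgue_on \<Omega>. norm (f x) \<le> C)"

text \<open>
  \<open>G x $ j $ i\<close> is the weak partial derivative of the \<open>j\<close>-th component in direction \<open>i\<close>;
  the norm on \<open>real^'n^'m\<close> is the Euclidean (Frobenius) one.
\<close>

definition has_weak_gradient ::
    "(real^'n) set \<Rightarrow> (real^'n \<Rightarrow> real^'m) \<Rightarrow> (real^'n \<Rightarrow> real^'n^'m) \<Rightarrow> bool" where
  "has_weak_gradient \<Omega> u G \<longleftrightarrow> L1_loc \<Omega> u \<and> L1_loc \<Omega> G \<and>
     (\<forall>\<phi> :: real^'n \<Rightarrow> real. test_fun \<Omega> \<phi> \<longrightarrow> (\<forall>i j.
        (LINT x|lebesgue_on \<Omega>. u x $ j * grad \<phi> x $ i) =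
        - (LINT x|lebesgue_on \<Omega>. G x $ j $ i * \<phi> x)))"

text \<open>The choice is immaterial: weak gradients on an open set are unique almost everywhere.\<close>

definition weak_gradient ::
    "(real^'n) set \<Rightarrow> (real^'n \<Rightarrow> real^'m) \<Rightarrow> real^'n \<Rightarrow> real^'n^'m" where
  "weak_gradient \<Omega> u = (SOME G. has_weak_gradient \<Omega> u G)"

definition W12 :: "(real^'n) set \<Rightarrow> (real^'n \<Rightarrow> real^'m) \<Rightarrow> bool" where
  "W12 \<Omega> u \<longleftrightarrow> (\<exists>G. has_weak_gradient \<Omega> u G \<and> L2 \<Omega> u \<and> L2 \<Omega> G)"

definition W12_loc :: "(real^'n) set \<Rightarrow> (real^'n \<Rightarrow> real^'m) \<Rightarrow> bool" where
  "W12_loc \<Omega> u \<longleftrightarrow> (\<exists>G. has_weak_gradient \<Omega> u G \<and> L2_loc \<Omega> u \<and> L2_loc \<Omega> G)"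

definition W12_norm :: "(real^'n) set \<Rightarrow> (real^'n \<Rightarrow> real^'m) \<Rightarrow> real" where
  "W12_norm \<Omega> u = sqrt ((LINT x|lebesgue_on \<Omega>. (norm (u x))\<^sup>2) +
                         (LINT x|lebesgue_on \<Omega>. (norm (weak_gradient \<Omega> u x))\<^sup>2))"

definition W12_0 :: "(real^'n) set \<Rightarrow> (real^'n \<Rightarrow> real^'m) \<Rightarrow> bool" where
  "W12_0 \<Omega> v \<longleftrightarrow> W12 \<Omega> v \<and>
     (\<exists>\<phi> :: nat \<Rightarrow> real^'n \<Rightarrow> real^'m. (\<forall>k. test_fun \<Omega> (\<phi> k)) \<and>
        (\<lambda>k. W12_norm \<Omega> (\<lambda>x. v x - \<phi> k x)) \<longlonglongrightarrow> 0)"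


section \<open>Minimal maps\<close>

text \<open>
  The energy takes values in \<open>[0, \<infinity>]\<close>, since \<open>W (u + v)\<close> need not be integrable for an
  unbounded perturbation \<open>v\<close>.  It is used for nonnegative \<open>W\<close> only: \<open>ennreal\<close> would
  truncate negative values.
\<close>

definition energy ::
    "(real^'m \<Rightarrow> real) \<Rightarrow> (real^'n) set \<Rightarrow> (real^'n \<Rightarrow> real^'m) \<Rightarrow> ennreal" where
  "energy W \<Omega> u =
     (\<integral>\<^sup>+x. ennreal (1/2 * (norm (weak_gradient \<Omega> u x))\<^sup>2 + W (u x)) \<partial>lebesgue_on \<Omega>)"

definition minimal_map ::
    "(real^'m \<Rightarrow> real) \<Rightarrow> (real^'n) set \<Rightarrow> (real^'n \<Rightarrow> real^'m) \<Rightarrow> bool" where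
  "minimal_map W D u \<longleftrightarrow>
     (\<forall>\<Omega> v. open \<Omega> \<and> bounded \<Omega> \<and> \<Omega> \<subseteq> D \<and> W12_0 \<Omega> v \<longrightarrow>
        energy W \<Omega> u \<le> energy W \<Omega> (\<lambda>x. u x + v x))"

text \<open>For open \<open>D\<close>.  The pointwise bounds are read almost everywhere, as \<open>u\<close> is a Sobolev function.\<close>

definition HB ::
    "(real^'m \<Rightarrow> real) \<Rightarrow> real^'m \<Rightarrow> (real^'n) set \<Rightarrow> (real^'n \<Rightarrow> real^'m) \<Rightarrow> bool" where
  "HB W a D u \<longleftrightarrow> W12_loc D u \<and> Linfty D u \<and> minimal_map W D u \<and>
     (\<exists>M>0. (AE x in lebesgue_on D. norm (u x - a) < M) \<and>
            (AE x in lebesgue_on D. norm (weak_gradient D u x) < M))"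

end

theory Submission
  imports Defs
begin

text \<open>
  Write \<open>e = \<bar>\<nabla>u\<bar>\<^sup>2 / 2 + W (u)\<close> for the energy density of \<open>u\<close> and \<open>I (R)\<close> for its integral over the ball of radius
  \<open>R\<close> about the origin.  The proof is a hole-filling argument that sets geometric against polynomial growth of \<open>I\<close>.

  Let \<open>\<psi>\<close> be a cutoff that is \<open>1\<close> on the ball of radius \<open>R - 1\<close> and \<open>0\<close> outside the ball of radius \<open>R\<close>, and compare \<open>u\<close> on
  the ball of radius \<open>R + 1\<close> with \<open>w = a + (1 - \<psi>) (u - a)\<close>.  Inside the smaller ball \<open>w = a\<close> has no energy.  In the
  shell the density of \<open>w\<close> is at most a constant multiple of \<open>e\<close>: the terms to be absorbed are \<open>\<bar>u - a\<bar>\<^sup>2\<close> and \<open>W (w)\<close>,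
  and \<open>W (u)\<close> controls both (lemma \<open>potential_controls\<close>).  Near \<open>a\<close> this is because the
  hypotheses on \<open>W\<close> make it increase at least quadratically along every ray from \<open>a\<close>; away from \<open>a\<close> it is compactness,
  since \<open>u\<close> is bounded and stays away from all other zeros of \<open>W\<close>.  Minimality then gives
  \<open>I (R + 1) \<le> C (I (R + 1) - I (R - 1))\<close> with \<open>C\<close> independent of \<open>R\<close> (lemma \<open>minimal_hole_filling\<close>), so that \<open>I\<close> would grow
  geometrically if it were not zero.  But \<open>e\<close> is bounded, whence \<open>I (R) = O(R\<^sup>n)\<close>.  Therefore \<open>e = 0\<close> almost
  everywhere, and \<open>W (u) = 0\<close> forces \<open>u = a\<close>.

  To use minimality, the perturbation \<open>\<psi> (a - u)\<close> has to be approximated by test functions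
  (lemma \<open>W12_0_compact_support\<close>), and the chosen weak gradients in the energies have to be identified
  (lemma \<open>weak_gradient_unique\<close>).  Both rest on mollification with an explicit \<open>C\<^sup>1\<close> kernel: mollifications of bounded
  functions converge in \<open>L\<^sup>1\<close> on bounded sets, which for bounded functions is as good as convergence in \<open>L\<^sup>2\<close>.
\<close>


section \<open>Functions of class C1 and test functions\<close>

text \<open>
  On a finite-dimensional space continuity of the derivative may be tested one direction at a time,
  which avoids building operator-valued functions by hand.
\<close>

lemma C1_onI:
  fixes f :: "'a::euclidean_space \<Rightarrow> 'b::real_normed_vector"
  assumes der: "\<And>x. (f has_derivative f' x) (at x)"
    and cont: "\<And>h. continuous_on UNIV (\<lambda>x. f' x h)"
  shows "C1_on UNIV f"
proof -
  have ap: "blinfun_apply (Blinfun (f' x)) = f' x" for x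
    by (rule bounded_linear_Blinfun_apply[OF has_derivative_bounded_linear[OF der]])
  have "continuous_on UNIV (\<lambda>x. Blinfun (f' x))"
    by (rule continuous_on_blinfun_componentwise) (simp add: ap cont)
  then show ?thesis
    unfolding C1_on_def using ap der by (intro exI[of _ "\<lambda>x. Blinfun (f' x)"]) auto
qed

lemma grad_eqI:
  assumes "GDERIV f x :> D"
  shows "grad f x = D"
  unfolding grad_def
proof (rule the_equality)
  show "GDERIV f x :> D" by fact
  fix E assume "GDERIV f x :> E"
  then have "(\<lambda>h. h \<bullet> E) = (\<lambda>h. h \<bullet> D)"
    using assms has_derivative_unique unfolding gderiv_def by blast
  then show "E = D" by (metis vector_eq_ldot)
qed

text \<open>
  The gradient is the Riesz representative of the derivative, found as the adjoint applied to \<open>1\<close>.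
\<close>

lemma C1_on_gderiv:
  fixes f :: "'a::euclidean_space \<Rightarrow> real"
  assumes "C1_on S f" "x \<in> S"
  shows "GDERIV f x :> grad f x"
proof -
  obtain f' where "(f has_derivative blinfun_apply (f' x)) (at x)"
    using assms unfolding C1_on_def by blast
  moreover have "blinfun_apply (f' x) = (\<lambda>h. h \<bullet> adjoint (blinfun_apply (f' x)) 1)"
    using adjoint_works[OF bounded_linear.linear[OF blinfun.bounded_linear_right], of _ "f' x" 1]
    by auto
  ultimately have "GDERIV f x :> adjoint (blinfun_apply (f' x)) 1"
    unfolding gderiv_def by metis
  then show ?thesis using grad_eqI by metis
qed

lemma C1_on_continuous_grad:
  fixes f :: "'a::euclidean_space \<Rightarrow> real"
  assumes "C1_on S f"
  shows "continuous_on S (grad f)"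
proof -
  obtain f' where f': "\<And>x. x \<in> S \<Longrightarrow> (f has_derivative blinfun_apply (f' x)) (at x)"
      and cont: "continuous_on S f'"
    using assms unfolding C1_on_def by blast
  have eq: "grad f x \<bullet> b = f' x b" if "x \<in> S" for x b
    using has_derivative_unique[OF f'[OF that] C1_on_gderiv[OF assms that, unfolded gderiv_def]]
    by (simp add: inner_commute)
  show ?thesis
    unfolding continuous_on_componentwise[of S "grad f"]
  proof
    fix b :: 'a assume "b \<in> Basis"
    have "continuous_on S (\<lambda>x. f' x b)" by (intro continuous_intros cont)
    then show "continuous_on S (\<lambda>x. grad f x \<bullet> b)"
      using eq by (simp cong: continuous_on_cong)
  qed
qed

lemma C1_onI_gderiv:
  fixes f :: "'a::euclidean_space \<Rightarrow> real"
  assumes "\<And>x. GDERIV f x :> g x" "continuous_on UNIV g"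
  shows "C1_on UNIV f"
  by (rule C1_onI[of f "\<lambda>x h. h \<bullet> g x"])
     (use assms in \<open>auto simp: gderiv_def intro!: continuous_intros\<close>)

lemma C1_on_continuous:
  assumes "C1_on UNIV f"
  shows "continuous_on UNIV f"
  using assms unfolding C1_on_def
  by (meson UNIV_I continuous_at_imp_continuous_on has_derivative_continuous)

lemma grad_eq_0_outside:
  fixes f :: "'a::euclidean_space \<Rightarrow> real"
  assumes "closed K" "\<And>x. x \<notin> K \<Longrightarrow> f x = 0" "x \<notin> K"
  shows "grad f x = 0"
proof (rule grad_eqI)
  have "((\<lambda>_. 0::real) has_derivative (\<lambda>h. 0)) (at x)" by simp
  then have "(f has_derivative (\<lambda>h. 0)) (at x)"
    by (rule has_derivative_transform_within_open[of _ _ _ _ "-K"]) (use assms in auto)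
  then show "GDERIV f x :> 0" by (simp add: gderiv_def)
qed

lemma test_funI:
  assumes "C1_on UNIV \<phi>" "compact K" "K \<subseteq> \<Omega>" "\<And>x. x \<notin> K \<Longrightarrow> \<phi> x = 0"
  shows "test_fun \<Omega> \<phi>"
proof -
  have "closure {x. \<phi> x \<noteq> 0} \<subseteq> K"
    by (rule closure_minimal) (use assms compact_imp_closed in auto)
  then show ?thesis
    unfolding test_fun_def using assms
    by (meson closed_closure compact_closure compact_imp_bounded bounded_subset closure_subset dual_order.trans)
qed

lemma test_funE:
  assumes "test_fun \<Omega> \<phi>"
  obtains K where "C1_on UNIV \<phi>" "compact K" "K \<subseteq> \<Omega>" "\<forall>x. x \<notin> K \<longrightarrow> \<phi> x = 0"
  using assms closure_subset unfolding test_fun_def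
  by (metis (mono_tags, lifting) mem_Collect_eq subsetD)

text \<open>
  The truncated square is the simplest function that is \<open>C\<^sup>1\<close> and vanishes on a half-line; kernels
  and cutoffs are both composed from it, so that one derivative computation serves all of them.
\<close>

definition pos_sq :: "real \<Rightarrow> real" where "pos_sq t = (max 0 t)\<^sup>2"

lemma pos_sq_deriv: "(pos_sq has_real_derivative 2 * max 0 t) (at t)"
proof -
  consider "t < 0" | "t > 0" | "t = 0" by linarith
  then show ?thesis
  proof cases
    case 1
    have "((\<lambda>_. 0) has_real_derivative 0) (at t)" by simp
    then have "(pos_sq has_real_derivative 0) (at t)"
      by (rule has_field_derivative_transform_within[of _ _ _ _ "-t"]) (use 1 in \<open>auto simp: pos_sq_def dist_real_def\<close>)
    then show ?thesis using 1 by simp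
  next
    case 2
    have "((\<lambda>t. t\<^sup>2) has_real_derivative 2 * t) (at t)"
      by (auto intro!: derivative_eq_intros)
    then have "(pos_sq has_real_derivative 2 * t) (at t)"
      by (rule has_field_derivative_transform_within[of _ _ _ _ t]) (use 2 in \<open>auto simp: pos_sq_def dist_real_def\<close>)
    then show ?thesis using 2 by simp
  next
    case 3
    have "((\<lambda>h. (pos_sq (0 + h) - pos_sq 0) / h) \<longlongrightarrow> 0) (at 0)"
    proof (rule Lim_null_comparison)
      show "\<forall>\<^sub>F h in at 0. norm ((pos_sq (0 + h) - pos_sq 0) / h) \<le> \<bar>h\<bar>"
        by (rule always_eventually) (auto simp: pos_sq_def max_def power2_eq_square)
      show "((\<lambda>h::real. \<bar>h\<bar>) \<longlongrightarrow> 0) (at 0)" by (auto intro!: tendsto_eq_intros)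
    qed
    then show ?thesis using 3 by (simp add: DERIV_def)
  qed
qed

definition bump :: "real \<Rightarrow> 'a::real_inner \<Rightarrow> real" where
  "bump r x = pos_sq (r\<^sup>2 - x \<bullet> x)"

lemma bump_pos_iff: "r > 0 \<Longrightarrow> bump r x > 0 \<longleftrightarrow> norm x < r"
proof -
  assume "r > 0"
  then have "norm x < r \<longleftrightarrow> x \<bullet> x < r\<^sup>2"
    by (metis abs_le_square_iff abs_norm_cancel abs_of_pos dot_square_norm not_le)
  then show ?thesis by (auto simp: bump_def pos_sq_def max_def)
qed

lemma bump_nonneg: "bump r x \<ge> 0"
  by (simp add: bump_def pos_sq_def)

lemma C1_bump: "C1_on UNIV (bump r :: 'a::euclidean_space \<Rightarrow> real)"
proof (rule C1_onI_gderiv)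
  show "GDERIV (bump r) x :> (2 * max 0 (r\<^sup>2 - x \<bullet> x)) *\<^sub>R (- 2 *\<^sub>R x)" for x :: 'a
    unfolding bump_def
    by (rule GDERIV_DERIV_compose[OF _ pos_sq_deriv], unfold gderiv_def)
       (auto intro!: derivative_eq_intros simp: inner_commute)
  show "continuous_on UNIV (\<lambda>x::'a. (2 * max 0 (r\<^sup>2 - x \<bullet> x)) *\<^sub>R (- 2 *\<^sub>R x))"
    by (intro continuous_intros)
qed


section \<open>Cutoff functions\<close>

text \<open>
  The map \<open>t \<mapsto> pos_sq (1 - pos_sq t)\<close> descends from \<open>1\<close> to \<open>0\<close> on the unit interval.  Its argument is the
  affine function of the squared norm that is \<open>0\<close> on the sphere of radius \<open>R - 1\<close> and \<open>1\<close> on the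
  sphere of radius \<open>R\<close>; working with the squared norm avoids the singularity at the origin.
\<close>

definition cutoff :: "real \<Rightarrow> 'a::real_inner \<Rightarrow> real" where
  "cutoff R x = pos_sq (1 - pos_sq ((x \<bullet> x - (R - 1)\<^sup>2) / (2 * R - 1)))"

lemma cutoff_bounds: "0 \<le> cutoff R x" "cutoff R x \<le> 1"
  by (auto simp: cutoff_def pos_sq_def max_def power_le_one)

lemma cutoff_eq_1: "norm x \<le> R - 1 \<Longrightarrow> cutoff R x = 1"
proof -
  assume "norm x \<le> R - 1"
  then have "x \<bullet> x \<le> (R - 1)\<^sup>2" "R \<ge> 1"
    using norm_ge_zero[of x] by (auto simp: dot_square_norm power_mono simp del: norm_ge_zero)
  then have "(x \<bullet> x - (R - 1)\<^sup>2) / (2 * R - 1) \<le> 0" by (simp add: divide_le_0_iff)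
  then show ?thesis by (simp add: cutoff_def pos_sq_def)
qed

lemma cutoff_eq_0: "R \<ge> 1 \<Longrightarrow> norm x \<ge> R \<Longrightarrow> cutoff R x = 0"
proof -
  assume R: "R \<ge> 1" and "norm x \<ge> R"
  then have "x \<bullet> x \<ge> R\<^sup>2" by (simp add: dot_square_norm)
  then have "(x \<bullet> x - (R - 1)\<^sup>2) / (2 * R - 1) \<ge> 1"
    using R by (simp add: le_divide_eq power2_eq_square algebra_simps)
  then have "pos_sq ((x \<bullet> x - (R - 1)\<^sup>2) / (2 * R - 1)) \<ge> 1"
    by (simp add: pos_sq_def max_def one_le_power)
  then show ?thesis by (simp add: cutoff_def pos_sq_def)
qed

text \<open>
  The shell has width one whatever the radius, so the slope is bounded independently of \<open>R\<close>.
  The growth argument compares balls whose radii differ by a constant, and its constant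
  must not depend on the radius.
\<close>

lemma cutoff_C1_grad:
  assumes R: "R \<ge> 1"
  shows "C1_on UNIV (cutoff R :: 'a::euclidean_space \<Rightarrow> real)"
    and "norm (grad (cutoff R) (x::'a)) \<le> 8"
proof -
  define q where "q x = (x \<bullet> x - (R - 1)\<^sup>2) / (2 * R - 1)" for x :: 'a
  define d where "d x = (2 * max 0 (1 - pos_sq (q x)) * (- (2 * max 0 (q x)))) *\<^sub>R ((2 / (2 * R - 1)) *\<^sub>R x)" for x
  have gq: "GDERIV q x :> (2 / (2 * R - 1)) *\<^sub>R x" for x
  proof -
    have "GDERIV (\<lambda>x. x \<bullet> x - (R - 1)\<^sup>2) x :> 2 *\<^sub>R x"
      unfolding gderiv_def by (auto intro!: derivative_eq_intros simp: inner_commute)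
    then show ?thesis
      using R unfolding gderiv_def q_def
      by (auto intro!: derivative_eq_intros simp: divide_inverse inner_commute algebra_simps)
  qed
  have "((\<lambda>t. pos_sq (1 - pos_sq t)) has_real_derivative 2 * max 0 (1 - pos_sq t) * (- (2 * max 0 t))) (at t)" for t
    by (rule DERIV_chain2[OF pos_sq_deriv]) (auto intro!: derivative_eq_intros pos_sq_deriv)
  from GDERIV_DERIV_compose[OF gq this]
  have g: "GDERIV (cutoff R) x :> d x" for x
    unfolding d_def q_def cutoff_def[abs_def] .
  show "C1_on UNIV (cutoff R :: 'a \<Rightarrow> real)"
    using R by (intro C1_onI_gderiv[OF g]) (auto simp: d_def q_def pos_sq_def intro!: continuous_intros)
  have *: "2 * max 0 (1 - pos_sq t) * (2 * max 0 t) \<le> 4" for t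
  proof (cases "t \<le> 1")
    case True
    then have "max 0 (1 - pos_sq t) * max 0 t \<le> 1 * 1"
      by (intro mult_mono) (auto simp: pos_sq_def)
    then show ?thesis by simp
  next
    case False
    then have "pos_sq t \<ge> 1" by (simp add: pos_sq_def max_def one_le_power)
    then show ?thesis by simp
  qed
  show "norm (grad (cutoff R) (x::'a)) \<le> 8"
  proof (cases "norm x \<le> R")
    case True
    have "norm (d x) = (2 * max 0 (1 - pos_sq (q x)) * (2 * max 0 (q x))) * (2 / (2 * R - 1) * norm x)"
      using R by (simp add: d_def abs_mult)
    also have "\<dots> \<le> 4 * (2 / (2 * R - 1) * R)"
      using R True * by (intro mult_mono) auto
    also have "\<dots> \<le> 8" using R by (simp add: field_simps)
    finally show ?thesis by (simp add: grad_eqI[OF g])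
  next
    case False
    have "grad (cutoff R) x = 0"
      by (rule grad_eq_0_outside[of "cball 0 R"]) (use False in \<open>auto intro!: cutoff_eq_0[OF R]\<close>)
    then show ?thesis by simp
  qed
qed

lemma grad_cutoff_eq_0:
  assumes "norm (x :: 'a::euclidean_space) < R - 1"
  shows "grad (cutoff R) x = 0"
proof (rule grad_eqI)
  have "((\<lambda>_. 1::real) has_derivative (\<lambda>h. 0)) (at x)" by simp
  then have "(cutoff R has_derivative (\<lambda>h. 0)) (at x)"
    by (rule has_derivative_transform_within_open[of _ _ _ _ "ball 0 (R - 1)"]) (use assms in \<open>auto simp: cutoff_eq_1\<close>)
  then show "GDERIV (cutoff R) x :> 0" by (simp add: gderiv_def)
qed


section \<open>Convolution\<close>

definition conv :: "('a::euclidean_space \<Rightarrow> real) \<Rightarrow> ('a \<Rightarrow> 'b::euclidean_space) \<Rightarrow> 'a \<Rightarrow> 'b" where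
  "conv \<phi> f x = (LINT y|lebesgue. \<phi> (x - y) *\<^sub>R f y)"

lemma L1_loc_iff:
  "L1_loc \<Omega> f \<longleftrightarrow> (\<forall>K. compact K \<and> K \<subseteq> \<Omega> \<longrightarrow> integrable lebesgue (\<lambda>x. indicator K x *\<^sub>R f x))"
  unfolding L1_loc_def set_integrable_def ..

lemma L1_loc_continuous:
  fixes f :: "real^'n \<Rightarrow> 'b::euclidean_space"
  assumes "continuous_on UNIV f"
  shows "L1_loc \<Omega> f"
  unfolding L1_loc_def
proof (intro allI impI)
  fix K :: "(real^'n) set" assume K: "compact K \<and> K \<subseteq> \<Omega>"
  then obtain a where a: "K \<subseteq> cbox (- a) a"
    using compact_imp_bounded bounded_subset_cbox_symmetric by metis
  have "f absolutely_integrable_on cbox (- a) a"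
    using assms continuous_on_subset by (intro absolutely_integrable_continuous) blast
  then show "f absolutely_integrable_on K"
    using K a by (meson set_integrable_subset lmeasurable_compact fmeasurableD)
qed

lemma borel_measurable_lebesgue_continuous:
  fixes f :: "'a::euclidean_space \<Rightarrow> 'b::euclidean_space"
  assumes "continuous_on UNIV f"
  shows "f \<in> borel_measurable lebesgue"
  using borel_measurable_continuous_onI[OF assms] by (simp add: measurable_completion)

lemma continuous_support_bounded:
  fixes \<phi> :: "'a::euclidean_space \<Rightarrow> 'b::euclidean_space"
  assumes "continuous_on UNIV \<phi>" "compact K" "\<And>x. x \<notin> K \<Longrightarrow> \<phi> x = 0"
  obtains B where "B \<ge> 0" "\<And>x. norm (\<phi> x) \<le> B"
proof -
  have "bounded (\<phi> ` K)"
    using assms by (meson compact_continuous_image compact_imp_bounded continuous_on_subset subset_UNIV)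
  then obtain B where B: "\<And>x. x \<in> K \<Longrightarrow> norm (\<phi> x) \<le> B" by (auto simp: bounded_iff)
  show ?thesis
  proof (rule that[of "\<bar>B\<bar>"])
    show "norm (\<phi> x) \<le> \<bar>B\<bar>" for x
      using B[of x] assms(3)[of x] by (cases "x \<in> K") auto
  qed simp
qed

lemma integrable_continuous_support_scaleR:
  fixes f :: "real^'n \<Rightarrow> 'b::euclidean_space"
  assumes f: "L1_loc \<Omega> f" and K: "compact K" "K \<subseteq> \<Omega>"
    and \<phi>: "continuous_on UNIV \<phi>" "\<And>x. x \<notin> K \<Longrightarrow> \<phi> x = 0"
  shows "integrable lebesgue (\<lambda>x. \<phi> x *\<^sub>R f x)"
proof -
  obtain B where B: "\<And>x. norm (\<phi> x) \<le> B" "B \<ge> 0"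
    using continuous_support_bounded[OF \<phi>(1) K(1) \<phi>(2)] by metis
  let ?g = "\<lambda>x. indicator K x *\<^sub>R f x"
  have g: "integrable lebesgue ?g" using f K by (auto simp: L1_loc_iff)
  have "integrable lebesgue (\<lambda>x. \<phi> x *\<^sub>R ?g x)"
  proof (rule Bochner_Integration.integrable_bound[of lebesgue "\<lambda>x. B *\<^sub>R ?g x"])
    show "(\<lambda>x. \<phi> x *\<^sub>R ?g x) \<in> borel_measurable lebesgue"
      using borel_measurable_integrable[OF g] borel_measurable_lebesgue_continuous[OF \<phi>(1)]
      by (rule borel_measurable_scaleR[rotated])
    show "AE x in lebesgue. norm (\<phi> x *\<^sub>R ?g x) \<le> norm (B *\<^sub>R ?g x)"
      using B by (intro AE_I2) (auto simp: indicator_def intro!: mult_right_mono)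
  qed (rule integrable_scaleR_right, rule g)
  moreover have "\<phi> x *\<^sub>R ?g x = \<phi> x *\<^sub>R f x" for x
    using \<phi>(2)[of x] by (cases "x \<in> K") simp_all
  ultimately show ?thesis by (simp only:)
qed

text \<open>
  Differences and difference quotients of a compactly supported kernel are uniformly small and live
  in one fixed compact set.  This estimate turns that into smallness of their integrals against a
  locally integrable function, without any dominated convergence.
\<close>

lemma norm_integral_scaleR_le:
  fixes f :: "real^'n \<Rightarrow> 'b::euclidean_space"
  assumes f: "L1_loc UNIV f" and K: "compact K" and b: "\<And>x. \<bar>\<psi> x\<bar> \<le> e"
    and 0: "\<And>x. x \<notin> K \<Longrightarrow> \<psi> x = 0"
  shows "norm (LINT x|lebesgue. \<psi> x *\<^sub>R f x) \<le> e * (LINT x|lebesgue. norm (indicator K x *\<^sub>R f x))"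
proof (cases "integrable lebesgue (\<lambda>x. \<psi> x *\<^sub>R f x)")
  case True
  have g: "integrable lebesgue (\<lambda>x. indicator K x *\<^sub>R f x)" using f K by (auto simp: L1_loc_iff)
  have "norm (LINT x|lebesgue. \<psi> x *\<^sub>R f x) \<le> (LINT x|lebesgue. norm (\<psi> x *\<^sub>R f x))"
    by (rule integral_norm_bound)
  also have "\<dots> \<le> (LINT x|lebesgue. e * norm (indicator K x *\<^sub>R f x))"
  proof (rule integral_mono)
    show "norm (\<psi> x *\<^sub>R f x) \<le> e * norm (indicator K x *\<^sub>R f x)" for x
      using b[of x] 0[of x] by (cases "x \<in> K") (auto intro!: mult_right_mono)
  qed (fact integrable_norm[OF True], fact integrable_mult_right[OF integrable_norm[OF g]])
  finally show ?thesis by simp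
next
  case False
  have "e \<ge> 0" using b[of undefined] by linarith
  then show ?thesis using False by (simp add: not_integrable_integral_eq)
qed

lemma compact_shift: "compact K \<Longrightarrow> compact ((\<lambda>y. x - y) ` K)" for x :: "'a::euclidean_space"
  by (intro compact_continuous_image continuous_intros)

lemma integrable_conv:
  fixes f :: "real^'n \<Rightarrow> 'b::euclidean_space"
  assumes f: "L1_loc UNIV f" and K: "compact K" "continuous_on UNIV \<phi>" "\<And>x. x \<notin> K \<Longrightarrow> \<phi> x = 0"
  shows "integrable lebesgue (\<lambda>y. \<phi> (x - y) *\<^sub>R f y)"
proof (rule integrable_continuous_support_scaleR[OF f])
  show "compact ((\<lambda>y. x - y) ` K)" using K compact_shift by blast
  show "continuous_on UNIV (\<lambda>y. \<phi> (x - y))"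
    by (rule continuous_on_compose2[OF K(2)]) (auto intro!: continuous_intros)
  show "\<phi> (x - y) = 0" if "y \<notin> (\<lambda>y. x - y) ` K" for y
  proof (rule K(3))
    show "x - y \<notin> K"
      using that image_eqI[of y "\<lambda>y. x - y" "x - y" K] by auto
  qed
qed auto

lemma compact_imp_subset_cball:
  fixes K :: "'a::euclidean_space set"
  assumes "compact K"
  obtains r where "r > 0" "K \<subseteq> cball 0 r"
  using bounded_subset_ballD[OF compact_imp_bounded[OF assms]] ball_subset_cball by blast

lemma uniformly_continuous_compact_support:
  fixes \<phi> :: "'a::euclidean_space \<Rightarrow> 'b::real_normed_vector"
  assumes "continuous_on UNIV \<phi>" "compact K" "\<And>x. x \<notin> K \<Longrightarrow> \<phi> x = 0" "e > 0"
  obtains d where "0 < d" "d \<le> 1" "\<And>x y. norm (x - y) < d \<Longrightarrow> norm (\<phi> x - \<phi> y) \<le> e"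
proof -
  obtain r where r: "K \<subseteq> cball 0 r"
    using assms(2) compact_imp_subset_cball by blast
  have "uniformly_continuous_on (cball 0 (r+1)) \<phi>"
    using assms by (meson compact_cball compact_uniformly_continuous continuous_on_subset subset_UNIV)
  then obtain d where d: "d > 0" "\<And>x y. x \<in> cball 0 (r+1) \<Longrightarrow> y \<in> cball 0 (r+1) \<Longrightarrow> dist x y < d
      \<Longrightarrow> dist (\<phi> x) (\<phi> y) < e"
    using assms(4) unfolding uniformly_continuous_on_def by (metis dist_commute)
  show ?thesis
  proof (rule that[of "min d 1"])
    show "norm (\<phi> x - \<phi> y) \<le> e" if l: "norm (x - y) < min d 1" for x y
    proof (cases "x \<in> K \<or> y \<in> K")
      case True
      have "norm x \<le> norm y + norm (x - y)" "norm y \<le> norm x + norm (x - y)"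
        using norm_triangle_sub[of x y] norm_triangle_sub[of y x] by (auto simp: norm_minus_commute)
      moreover have "norm x \<le> r \<or> norm y \<le> r" using True r by (auto simp: subset_iff)
      ultimately have "norm x \<le> r + 1" "norm y \<le> r + 1" using l by auto
      then show ?thesis using d(2)[of x y] l by (auto simp: dist_norm)
    next
      case False
      then show ?thesis using assms by simp
    qed
  qed (use d in auto)
qed

lemma continuous_on_conv:
  fixes f :: "real^'n \<Rightarrow> 'b::euclidean_space"
  assumes f: "L1_loc UNIV f" and K: "compact K" "continuous_on UNIV \<phi>" "\<And>x. x \<notin> K \<Longrightarrow> \<phi> x = 0"
  shows "continuous_on UNIV (conv \<phi> f)"
  unfolding continuous_on_iff
proof (intro ballI allI impI)
  fix x :: "real^'n" and e :: real assume e: "e > 0"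
  obtain r where r: "K \<subseteq> cball 0 r"
    using K compact_imp_subset_cball by blast
  define C where "C = (LINT y|lebesgue. norm (indicator (cball x (r+1)) y *\<^sub>R f y))"
  have C: "C \<ge> 0" unfolding C_def by simp
  obtain d where d: "0 < d" "d \<le> 1" "\<And>x y. norm (x - y) < d \<Longrightarrow> norm (\<phi> x - \<phi> y) \<le> e / (C + 1)"
    by (rule uniformly_continuous_compact_support[OF K(2,1,3), of "e / (C+1)"]) (use e C in auto)
  show "\<exists>d>0. \<forall>x'\<in>UNIV. dist x' x < d \<longrightarrow> dist (conv \<phi> f x') (conv \<phi> f x) < e"
  proof (intro exI[of _ d] conjI ballI impI)
    fix x' assume x': "dist x' x < d"
    have "norm (conv \<phi> f x' - conv \<phi> f x) = norm (LINT y|lebesgue. (\<phi> (x' - y) - \<phi> (x - y)) *\<^sub>R f y)"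
      unfolding conv_def using integrable_conv[OF f K]
      by (subst Bochner_Integration.integral_diff[symmetric]) (auto simp: scaleR_diff_left)
    also have "\<dots> \<le> e / (C + 1) * C"
      unfolding C_def
    proof (rule norm_integral_scaleR_le[OF f compact_cball])
      show "\<bar>\<phi> (x' - y) - \<phi> (x - y)\<bar> \<le> e / ((LINT y|lebesgue. norm (indicator (cball x (r + 1)) y *\<^sub>R f y)) + 1)" for y
        using d(3)[of "x' - y" "x - y"] x' by (simp add: dist_norm C_def)
      show "\<phi> (x' - y) - \<phi> (x - y) = 0" if "y \<notin> cball x (r + 1)" for y
      proof -
        have "norm (x - y) \<le> norm (x' - y) + norm (x' - x)"
          using norm_triangle_ineq[of "x' - y" "x - x'"] by (simp add: norm_minus_commute)
        then have "norm (x - y) > r" "norm (x' - y) > r"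
          using that x' d by (auto simp: dist_norm)
        then have "x - y \<notin> K" "x' - y \<notin> K" using r by auto
        then show ?thesis using K by simp
      qed
    qed
    also have "\<dots> < e" using e C by (simp add: field_simps)
    finally show "dist (conv \<phi> f x') (conv \<phi> f x) < e" by (simp add: dist_norm)
  qed (use d in auto)
qed

text \<open>
  The first-order Taylor remainder of the kernel is \<open>o(h)\<close> uniformly in the base point, because its
  gradient is uniformly continuous.
\<close>

lemma has_derivative_conv:
  fixes f :: "real^'n \<Rightarrow> 'b::euclidean_space"
  assumes f: "L1_loc UNIV f" and K: "compact K" "C1_on UNIV \<phi>" "\<And>x. x \<notin> K \<Longrightarrow> \<phi> x = 0"
  shows "(conv \<phi> f has_derivative (\<lambda>h. conv (\<lambda>z. h \<bullet> grad \<phi> z) f x)) (at x)"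
  unfolding has_derivative_at_alt
proof (intro conjI allI impI)
  have cont: "continuous_on UNIV \<phi>" "continuous_on UNIV (grad \<phi>)"
    using K(2) C1_on_continuous C1_on_continuous_grad by blast+
  have g0: "grad \<phi> z = 0" if "z \<notin> K" for z
    by (rule grad_eq_0_outside[of K]) (use K that compact_imp_closed in auto)
  have int: "integrable lebesgue (\<lambda>y. (h \<bullet> grad \<phi> (x - y)) *\<^sub>R f y)" for x h
    by (rule integrable_conv[OF f K(1), of "\<lambda>z. h \<bullet> grad \<phi> z"])
       (auto intro!: continuous_intros cont g0 simp: g0)
  have int0: "integrable lebesgue (\<lambda>y. \<phi> (x - y) *\<^sub>R f y)" for x
    by (rule integrable_conv[OF f K(1) cont(1) K(3)])
  have "linear (\<lambda>h. conv (\<lambda>z. h \<bullet> grad \<phi> z) f x)"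
  proof (rule linearI)
    show "conv (\<lambda>z. (h1 + h2) \<bullet> grad \<phi> z) f x = conv (\<lambda>z. h1 \<bullet> grad \<phi> z) f x + conv (\<lambda>z. h2 \<bullet> grad \<phi> z) f x" for h1 h2
      unfolding conv_def
      by (subst Bochner_Integration.integral_add[symmetric, OF int int])
         (simp add: inner_add_left scaleR_add_left)
    show "conv (\<lambda>z. (c *\<^sub>R h) \<bullet> grad \<phi> z) f x = c *\<^sub>R conv (\<lambda>z. h \<bullet> grad \<phi> z) f x" for c h
      unfolding conv_def
      by (subst integral_scaleR_right[symmetric]) simp
  qed
  then show "bounded_linear (\<lambda>h. conv (\<lambda>z. h \<bullet> grad \<phi> z) f x)"
    by (simp add: linear_conv_bounded_linear)
  fix e :: real assume e: "e > 0"
  obtain r where r: "K \<subseteq> cball 0 r"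
    using K compact_imp_subset_cball by blast
  define C where "C = (LINT y|lebesgue. norm (indicator (cball x (r+1)) y *\<^sub>R f y))"
  have C: "C \<ge> 0" unfolding C_def by simp
  define e' where "e' = e / (C + 1)"
  have e': "e' > 0" using e C by (simp add: e'_def)
  obtain d where d: "0 < d" "d \<le> 1" "\<And>x y. norm (x - y) < d \<Longrightarrow> norm (grad \<phi> x - grad \<phi> y) \<le> e'"
    using uniformly_continuous_compact_support[OF cont(2) K(1) g0 e'] by blast
  have lin: "\<bar>\<phi> (z + h) - \<phi> z - h \<bullet> grad \<phi> z\<bar> \<le> norm h * e'" if h: "norm h < d" for z h
  proof -
    have "norm (\<phi> (z + h) - \<phi> z - (z + h - z) \<bullet> grad \<phi> z) \<le> norm (z + h - z) * e'"
    proof (rule differentiable_bound_linearization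
          [where S = "ball z d" and f' = "\<lambda>w h. h \<bullet> grad \<phi> w" and ?x0.0 = z])
      show "z + t *\<^sub>R (z + h - z) \<in> ball z d" if "t \<in> {0..1}" for t
        using that h d mult_left_le_one_le[of "norm h" t] by (auto simp: dist_norm)
      show "(\<phi> has_derivative (\<lambda>h. h \<bullet> grad \<phi> w)) (at w within ball z d)" for w
        using C1_on_gderiv[OF K(2)] unfolding gderiv_def by (simp add: has_derivative_at_withinI)
      show "onorm ((\<lambda>h. h \<bullet> grad \<phi> w) - (\<lambda>h. h \<bullet> grad \<phi> z)) \<le> e'" if "w \<in> ball z d" for w
      proof (rule onorm_bound)
        show "norm (((\<lambda>h. h \<bullet> grad \<phi> w) - (\<lambda>h. h \<bullet> grad \<phi> z)) h) \<le> e' * norm h" for h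
        proof -
          have "\<bar>h \<bullet> (grad \<phi> w - grad \<phi> z)\<bar> \<le> norm h * norm (grad \<phi> w - grad \<phi> z)"
            by (rule Cauchy_Schwarz_ineq2)
          also have "\<dots> \<le> norm h * e'"
            using that d(3)[of w z] by (intro mult_left_mono) (auto simp: dist_norm norm_minus_commute)
          finally show ?thesis by (simp add: inner_diff_right mult.commute)
        qed
      qed (use e' in auto)
      show "z \<in> ball z d" using d by simp
    qed
    then show ?thesis by simp
  qed
  show "\<exists>d>0. \<forall>x'. norm (x' - x) < d \<longrightarrow>
      norm (conv \<phi> f x' - conv \<phi> f x - conv (\<lambda>z. (x' - x) \<bullet> grad \<phi> z) f x) \<le> e * norm (x' - x)"
  proof (intro exI[of _ d] conjI allI impI)
    fix x' assume x': "norm (x' - x) < d"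
    let ?\<psi> = "\<lambda>y. \<phi> (x' - y) - \<phi> (x - y) - (x' - x) \<bullet> grad \<phi> (x - y)"
    have "norm (conv \<phi> f x' - conv \<phi> f x - conv (\<lambda>z. (x' - x) \<bullet> grad \<phi> z) f x) =
       norm (LINT y|lebesgue. ?\<psi> y *\<^sub>R f y)"
      unfolding conv_def using int0 int
      by (subst Bochner_Integration.integral_diff[symmetric],simp,simp)
         (subst Bochner_Integration.integral_diff[symmetric], auto simp: scaleR_diff_left)
    also have "\<dots> \<le> (norm (x' - x) * e') * C"
      unfolding C_def
    proof (rule norm_integral_scaleR_le[OF f compact_cball])
      show "\<bar>?\<psi> y\<bar> \<le> norm (x' - x) * e'" for y
        using lin[OF x', of "x - y"] by simp
      show "?\<psi> y = 0" if "y \<notin> cball x (r + 1)" for y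
      proof -
        have "norm (x - y) \<le> norm (x' - y) + norm (x' - x)"
          using norm_triangle_ineq[of "x' - y" "x - x'"] by (simp add: norm_minus_commute)
        then have "norm (x - y) > r" "norm (x' - y) > r"
          using that x' d by (auto simp: dist_norm)
        then have "x - y \<notin> K" "x' - y \<notin> K" using r by auto
        then show ?thesis using K g0 by simp
      qed
    qed
    also have "\<dots> = norm (x' - x) * (e' * C)" by simp
    also have "\<dots> \<le> norm (x' - x) * e"
      using e C by (intro mult_left_mono) (auto simp: e'_def field_simps)
    finally show "norm (conv \<phi> f x' - conv \<phi> f x - conv (\<lambda>z. (x' - x) \<bullet> grad \<phi> z) f x) \<le> e * norm (x' - x)"
      by (simp add: mult.commute)
  qed (use d in auto)
qed

lemma C1_on_conv:
  fixes f :: "real^'n \<Rightarrow> 'b::euclidean_space"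
  assumes f: "L1_loc UNIV f" and K: "compact K" "C1_on UNIV \<phi>" "\<And>x. x \<notin> K \<Longrightarrow> \<phi> x = 0"
  shows "C1_on UNIV (conv \<phi> f)"
proof (rule C1_onI[OF has_derivative_conv[OF assms]])
  have g0: "grad \<phi> z = 0" if "z \<notin> K" for z
    by (rule grad_eq_0_outside[of K]) (use K that compact_imp_closed in auto)
  show "continuous_on UNIV (\<lambda>x. conv (\<lambda>z. h \<bullet> grad \<phi> z) f x)" for h
    by (rule continuous_on_conv[OF f K(1), of "\<lambda>z. h \<bullet> grad \<phi> z"])
       (auto intro!: continuous_intros C1_on_continuous_grad K simp: g0)
qed


section \<open>Mollifiers\<close>

definition mollifier :: "real \<Rightarrow> 'a::euclidean_space \<Rightarrow> real" where
  "mollifier r x = bump r x / (LINT y|lebesgue. bump r (y::'a))"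

lemma bump_eq_0: "x \<notin> cball 0 r \<Longrightarrow> r > 0 \<Longrightarrow> bump r x = 0"
  using bump_pos_iff[of r x] bump_nonneg[of r x] by auto

lemma integrable_bump: "r > 0 \<Longrightarrow> integrable lebesgue (bump r :: real^'n \<Rightarrow> real)"
proof -
  assume "r > 0"
  have "integrable lebesgue (\<lambda>x::real^'n. bump r x *\<^sub>R (1::real))"
  proof (rule integrable_continuous_support_scaleR[of UNIV _ "cball 0 r"])
    show "L1_loc UNIV (\<lambda>x::real^'n. 1::real)"
      by (intro L1_loc_continuous continuous_on_const)
  qed (use \<open>r > 0\<close> C1_bump C1_on_continuous bump_eq_0 in auto)
  then show ?thesis by simp
qed

lemma integral_bump_pos: "r > 0 \<Longrightarrow> (LINT y|lebesgue. bump r (y::real^'n)) > 0"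
proof -
  assume r: "r > 0"
  have "\<not> (AE y::real^'n in lebesgue. bump r y = 0)"
  proof
    assume "AE y::real^'n in lebesgue. bump r y = 0"
    then have "AE y::real^'n in lebesgue. y \<notin> ball 0 r"
      by eventually_elim (use bump_pos_iff[OF r] in force)
    then have "ball (0::real^'n) r \<in> null_sets lebesgue"
      by (simp add: AE_iff_null_sets fmeasurableD)
    then show False using r open_not_negligible[of "ball (0::real^'n) r"]
      by (simp add: negligible_iff_null_sets)
  qed
  then show ?thesis
    using integral_nonneg_eq_0_iff_AE[OF integrable_bump[OF r, where 'n='n]]
      integral_nonneg_AE[of "bump r :: real^'n \<Rightarrow> real" lebesgue]
    by (simp add: bump_nonneg less_le)
qed

lemma mollifier_nonneg: "mollifier r (x::real^'n) \<ge> 0"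
  unfolding mollifier_def by (intro divide_nonneg_nonneg bump_nonneg integral_nonneg_AE AE_I2)

lemma mollifier_minus: "mollifier r (- x) = mollifier r x"
  by (simp add: mollifier_def bump_def)

lemma mollifier_eq_0: "r > 0 \<Longrightarrow> x \<notin> cball 0 r \<Longrightarrow> mollifier r x = 0"
  by (simp add: mollifier_def bump_eq_0)

lemma C1_mollifier: "C1_on UNIV (mollifier r :: real^'n \<Rightarrow> real)"
proof (rule C1_onI_gderiv)
  let ?c = "inverse (LINT y|lebesgue. bump r (y::real^'n))"
  have "GDERIV (\<lambda>x. bump r x * ?c) x :> ?c *\<^sub>R grad (bump r) x" for x :: "real^'n"
    using C1_on_gderiv[OF C1_bump, of x r] unfolding gderiv_def
    by (auto intro!: derivative_eq_intros)
  then show "GDERIV (mollifier r) x :> ?c *\<^sub>R grad (bump r) x" for x :: "real^'n"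
    by (simp add: mollifier_def[abs_def] divide_inverse)
  show "continuous_on UNIV (\<lambda>x::real^'n. ?c *\<^sub>R grad (bump r) x)"
    by (intro continuous_intros C1_on_continuous_grad C1_bump)
qed

lemmas continuous_mollifier = C1_on_continuous[OF C1_mollifier]

lemma borel_measurable_mollifier [measurable]: "mollifier r \<in> borel_measurable (borel :: (real^'n) measure)"
  by (intro borel_measurable_continuous_onI continuous_mollifier)

lemma nn_integral_mollifier: 
  assumes r: "r > 0"
  shows "(\<integral>\<^sup>+x. ennreal (mollifier r x) \<partial>(lborel::(real^'n) measure)) = 1"
proof -
  have "integrable lebesgue (mollifier r :: real^'n \<Rightarrow> real)"
    unfolding mollifier_def using integrable_bump[OF r] by auto
  then have "(\<integral>\<^sup>+x. ennreal (mollifier r x) \<partial>(lebesgue::(real^'n) measure)) = ennreal (LINT y|lebesgue. mollifier r (y::real^'n))"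
    by (intro nn_integral_eq_integral) (auto simp: mollifier_nonneg)
  also have "(LINT y|lebesgue. mollifier r (y::real^'n)) = 1"
    using integral_bump_pos[OF r, where 'n='n] by (simp add: mollifier_def[abs_def])
  finally show ?thesis by (simp add: nn_integral_completion)
qed

text \<open>
  Reflections preserve Lebesgue measure; this is the affine change of variables with factor \<open>-1\<close>.
\<close>

lemma nn_integral_lborel_reflect:
  fixes f :: "'a::euclidean_space \<Rightarrow> ennreal"
  assumes [measurable]: "f \<in> borel_measurable borel"
  shows "(\<integral>\<^sup>+x. f (t - x) \<partial>lborel) = (\<integral>\<^sup>+x. f x \<partial>lborel)"
proof -
  have eq: "(lborel :: 'a measure) = distr lborel borel (\<lambda>x. t - x)"
    using lborel_affine[of "-1" t] by (simp add: density_1)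
  have "(\<integral>\<^sup>+x. f x \<partial>(lborel::'a measure)) = (\<integral>\<^sup>+x. f x \<partial>distr lborel borel (\<lambda>x. t - x))"
    using eq by simp
  also have "\<dots> = (\<integral>\<^sup>+x. f (t - x) \<partial>lborel)"
    by (rule nn_integral_distr) auto
  finally show ?thesis by simp
qed

lemma nn_integral_mollifier_shift: 
  assumes r: "r > 0"
  shows "(\<integral>\<^sup>+y. ennreal (mollifier r (x - y)) \<partial>(lborel::(real^'n) measure)) = 1"
  and "(\<integral>\<^sup>+y. ennreal (mollifier r (y - x)) \<partial>(lborel::(real^'n) measure)) = 1"
  using nn_integral_lborel_reflect[of "\<lambda>z. ennreal (mollifier r z)" x] nn_integral_mollifier[OF r]
    mollifier_minus[of r "x - y" for y] by simp_all

lemma has_bochner_integral_mollifier: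
  assumes r: "r > 0"
  shows "has_bochner_integral lebesgue (\<lambda>y. mollifier r (x - y :: real^'n)) 1"
proof (rule has_bochner_integral_nn_integral)
  show "(\<lambda>y. mollifier r (x - y)) \<in> borel_measurable lebesgue"
    by (intro borel_measurable_lebesgue_continuous continuous_on_compose2[OF continuous_mollifier])
       (auto intro!: continuous_intros)
  show "(\<integral>\<^sup>+ y. ennreal (mollifier r (x - y)) \<partial>lebesgue) = ennreal 1"
    using nn_integral_mollifier_shift[OF r] by (simp add: nn_integral_completion)
qed (auto simp: mollifier_nonneg)

text \<open>
  When the convolution integral does not converge, its value is \<open>0\<close> by convention, so the bound holds
  for every \<open>f\<close>.
\<close>

lemma norm_conv_le:
  fixes f :: "real^'n \<Rightarrow> 'b::euclidean_space"
  shows "ennreal (norm (conv (mollifier r) f x)) \<le> (\<integral>\<^sup>+y. ennreal (mollifier r (x - y)) * ennreal (norm (f y)) \<partial>lebesgue)"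
proof (cases "integrable lebesgue (\<lambda>y. mollifier r (x - y) *\<^sub>R f y)")
  case True
  then show ?thesis
    using integral_norm_bound_ennreal[OF True]
    by (simp add: conv_def ennreal_mult mollifier_nonneg)
qed (simp add: conv_def not_integrable_integral_eq)

text \<open>
  Young's inequality for a kernel of mass one, by Tonelli.  Tonelli needs product measurability, hence the
  passage to a Borel representative of \<open>norm \<circ> f\<close>.
\<close>

lemma nn_integral_conv_le:
  fixes f :: "real^'n \<Rightarrow> 'b::euclidean_space"
  assumes f: "f \<in> borel_measurable lebesgue" and r: "r > 0"
  shows "(\<integral>\<^sup>+x. norm (conv (mollifier r) f x) \<partial>lebesgue) \<le> (\<integral>\<^sup>+x. norm (f x) \<partial>lebesgue)"
proof -
  have "(\<lambda>x. norm (f x)) \<in> borel_measurable lebesgue" using f by measurable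
  then obtain g where g[measurable]: "g \<in> borel_measurable lborel" and eq: "AE x in lborel. norm (f x) = g x"
    using completion_ex_borel_measurable_real by blast
  have g': "AE x in lebesgue. norm (f x) = g x" using eq by (rule AE_completion)
  have "(\<integral>\<^sup>+x. norm (conv (mollifier r) f x) \<partial>lebesgue)
      \<le> (\<integral>\<^sup>+x. \<integral>\<^sup>+y. ennreal (mollifier r (x - y)) * ennreal (norm (f y)) \<partial>lebesgue \<partial>lebesgue)"
    by (intro nn_integral_mono norm_conv_le)
  also have "\<dots> = (\<integral>\<^sup>+x. \<integral>\<^sup>+y. ennreal (mollifier r (x - y)) * ennreal (g y) \<partial>lborel \<partial>lborel)"
    unfolding nn_integral_completion
    by (rule nn_integral_cong, rule nn_integral_cong_AE, rule AE_mp[OF eq], rule AE_I2) simp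
  also have "\<dots> = (\<integral>\<^sup>+y. \<integral>\<^sup>+x. ennreal (mollifier r (x - y)) * ennreal (g y) \<partial>lborel \<partial>lborel)"
    by (rule lborel_pair.Fubini'[symmetric]) measurable
  also have "\<dots> = (\<integral>\<^sup>+y. ennreal (g y) \<partial>lborel)"
    by (intro nn_integral_cong) (simp add: nn_integral_multc nn_integral_mollifier_shift(2)[OF r])
  also have "\<dots> = (\<integral>\<^sup>+x. norm (f x) \<partial>lborel)"
    by (rule nn_integral_cong_AE, rule AE_mp[OF eq], rule AE_I2) simp
  finally show ?thesis by (simp add: nn_integral_completion)
qed

lemma AE_bound_nonneg:
  fixes f :: "real^'n \<Rightarrow> 'b::real_normed_vector"
  assumes "AE x in lebesgue. norm (f x) \<le> B"
  shows "B \<ge> 0"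
proof (rule ccontr)
  assume "\<not> B \<ge> 0"
  then have "\<not> norm (f x) \<le> B" for x using norm_ge_zero[of "f x"] by linarith
  then have "AE x in (lebesgue::(real^'n) measure). False" using assms by simp
  then show False by (simp add: ae_filter_eq_bot_iff trivial_limit_def[symmetric])
qed

lemma norm_conv_bound:
  fixes f :: "real^'n \<Rightarrow> 'b::euclidean_space"
  assumes B: "AE x in lebesgue. norm (f x) \<le> B" and r: "r > 0"
  shows "norm (conv (mollifier r) f x) \<le> B"
proof -
  have B0: "B \<ge> 0" using AE_bound_nonneg[OF B] .
  have "ennreal (norm (conv (mollifier r) f x)) \<le> (\<integral>\<^sup>+y. ennreal (mollifier r (x - y)) * ennreal (norm (f y)) \<partial>lebesgue)"
    by (rule norm_conv_le)
  also have "\<dots> \<le> (\<integral>\<^sup>+y. ennreal (mollifier r (x - y)) * ennreal B \<partial>lebesgue)"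
    by (rule nn_integral_mono_AE, rule AE_mp[OF B], rule AE_I2) (auto intro!: mult_left_mono ennreal_leI)
  also have "\<dots> = ennreal B"
    by (simp add: nn_integral_completion nn_integral_multc nn_integral_mollifier_shift[OF r])
  finally show ?thesis using B0 by simp
qed

lemma conv_mollifier_eq_0:
  fixes f :: "real^'n \<Rightarrow> 'b::euclidean_space"
  assumes r: "r > 0" and supp: "\<And>x. x \<notin> cball 0 R \<Longrightarrow> f x = 0" and x: "norm x > R + r"
  shows "conv (mollifier r) f x = 0"
proof -
  have z: "mollifier r (x - y) *\<^sub>R f y = 0" for y
  proof (cases "norm (x - y) \<le> r")
    case True
    then have "norm y > R" using x norm_triangle_sub[of x y] by auto
    then show ?thesis by (simp add: supp)
  next
    case False
    then show ?thesis using mollifier_eq_0[OF r, of "x - y"] by simp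
  qed
  show ?thesis unfolding conv_def z by simp
qed

lemma L1_loc_bounded:
  fixes f :: "real^'n \<Rightarrow> 'b::euclidean_space"
  assumes "f \<in> borel_measurable lebesgue" "AE x in lebesgue. norm (f x) \<le> B"
  shows "L1_loc \<Omega> f"
  unfolding L1_loc_iff
proof (intro allI impI)
  fix K :: "(real^'n) set" assume "compact K \<and> K \<subseteq> \<Omega>"
  then have K: "K \<in> lmeasurable" by (simp add: lmeasurable_compact)
  show "integrable lebesgue (\<lambda>x. indicator K x *\<^sub>R f x)"
  proof (rule Bochner_Integration.integrable_bound[of lebesgue "\<lambda>x. indicator K x * B"])
    show "integrable lebesgue (\<lambda>x. indicator K x * B)"
      using K by (intro integrable_mult_left) (auto simp: fmeasurable_def)
    show "(\<lambda>x. indicator K x *\<^sub>R f x) \<in> borel_measurable lebesgue"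
      using K assms by (intro borel_measurable_scaleR borel_measurable_indicator) auto
    show "AE x in lebesgue. norm (indicator K x *\<^sub>R f x) \<le> norm (indicator K x * B)"
      using assms(2) by eventually_elim (auto simp: indicator_def)
  qed
qed


section \<open>Convergence of mollifications\<close>

text \<open>
  Lebesgue measurable functions are almost everywhere limits of continuous ones.  Composing with the nearest-point
  projection onto a ball makes the approximants respect the bound and leaves the limit unchanged.
\<close>

lemma bounded_continuous_approximation:
  fixes f :: "real^'n \<Rightarrow> 'b::euclidean_space"
  assumes f: "f \<in> borel_measurable lebesgue" and B: "AE x in lebesgue. norm (f x) \<le> B"
  obtains g :: "nat \<Rightarrow> real^'n \<Rightarrow> 'b" where "\<And>n. continuous_on UNIV (g n)"
    "\<And>n x. norm (g n x) \<le> B" "AE x in lebesgue. (\<lambda>n. g n x) \<longlonglongrightarrow> f x"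
proof -
  have B0: "B \<ge> 0" using AE_bound_nonneg[OF B] .
  obtain N h where N: "negligible N" and h: "\<And>n. continuous_on UNIV (h n)"
    and lim: "\<And>x. x \<notin> N \<Longrightarrow> (\<lambda>n. h n x) \<longlonglongrightarrow> f x"
    using lebesgue_measurable_imp_measurable_on[OF f, of UNIV] unfolding measurable_on_def by auto
  let ?P = "closest_point (cball (0::'b) B)"
  have cP: "continuous_on UNIV ?P"
    using B0 by (intro continuous_on_closest_point) auto
  have AN: "AE x in lebesgue. x \<notin> N"
    using N by (simp add: AE_not_in negligible_iff_null_sets)
  show ?thesis
  proof (rule that[of "\<lambda>n x. ?P (h n x)"])
    show "continuous_on UNIV (\<lambda>x. ?P (h n x))" for n
      by (rule continuous_on_compose2[OF cP h]) auto
    show "norm (?P (h n x)) \<le> B" for n x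
      using closest_point_in_set[of "cball (0::'b) B" "h n x"] B0 by auto
    show "AE x in lebesgue. (\<lambda>n. ?P (h n x)) \<longlonglongrightarrow> f x"
      using AN B
    proof eventually_elim
      case (elim x)
      have "(\<lambda>n. ?P (h n x)) \<longlonglongrightarrow> ?P (f x)"
        using continuous_on_tendsto_compose[OF cP lim[OF elim(1)]] by auto
      moreover have "?P (f x) = f x" using elim(2) by (intro closest_point_self) auto
      ultimately show ?case by simp
    qed
  qed
qed

text \<open>
  Replace \<open>f\<close> near the ball by a continuous function \<open>c\<close> that is close in \<open>L\<^sup>1\<close>.  Mollification moves
  \<open>c\<close> uniformly little, by uniform continuity on a compact set, and does not increase the \<open>L\<^sup>1\<close> norm of
  the error \<open>f - c\<close>.
\<close>

lemma conv_L1_approx: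
  fixes f :: "real^'n \<Rightarrow> 'b::euclidean_space"
  assumes f: "f \<in> borel_measurable lebesgue" and B: "AE x in lebesgue. norm (f x) \<le> B" and e: "e > 0"
  obtains d where "d > 0" "\<And>r. 0 < r \<Longrightarrow> r < d \<Longrightarrow>
    (\<integral>\<^sup>+x. ennreal (norm (conv (mollifier r) f x - f x)) * indicator (cball 0 R) x \<partial>lebesgue) \<le> ennreal e"
proof -
  have B0: "B \<ge> 0" using AE_bound_nonneg[OF B] .
  obtain g where g: "\<And>n. continuous_on UNIV (g n)" "\<And>n x. norm (g n x) \<le> B"
     and lim: "AE x in lebesgue. (\<lambda>n. g n x) \<longlonglongrightarrow> f x"
    using bounded_continuous_approximation[OF f B] by blast
  have gm: "g n \<in> borel_measurable lebesgue" for n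
    using g(1) by (rule borel_measurable_lebesgue_continuous)
  let ?D = "\<lambda>n. \<integral>\<^sup>+x. ennreal (norm (indicator (cball 0 (R+1)) x *\<^sub>R (f x - g n x))) \<partial>lebesgue"
  have cm: "cball (0::real^'n) R \<in> sets lebesgue" for R by (simp add: fmeasurableD)
  have "?D \<longlonglongrightarrow> (\<integral>\<^sup>+x. 0 \<partial>(lebesgue::(real^'n) measure))"
  proof (rule nn_integral_dominated_convergence[where w="\<lambda>x. ennreal (2 * B) * indicator (cball 0 (R+1)) x"])
    show "(\<lambda>x. ennreal (norm (indicator (cball 0 (R+1)) x *\<^sub>R (f x - g n x)))) \<in> borel_measurable lebesgue" for n
      using f gm cm by measurable
    show "(\<lambda>x. ennreal (2 * B) * indicator (cball 0 (R+1)) x) \<in> borel_measurable (lebesgue::(real^'n) measure)"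
      using cm by measurable
    show "(\<integral>\<^sup>+ x. ennreal (2 * B) * indicator (cball 0 (R + 1)) x \<partial>(lebesgue::(real^'n) measure)) < \<infinity>"
      using lmeasurable_cball[of "0::real^'n" "R+1"]
      by (simp add: nn_integral_cmult_indicator cm ennreal_mult_less_top fmeasurable_def)
    show "AE x in lebesgue. ennreal (norm (indicator (cball 0 (R+1)) x *\<^sub>R (f x - g n x)))
        \<le> ennreal (2 * B) * indicator (cball 0 (R+1)) x" for n
      using B
    proof eventually_elim
      case (elim x)
      then have "norm (f x - g n x) \<le> 2 * B"
        using g(2)[of n x] norm_triangle_ineq4[of "f x" "g n x"] by linarith
      then show ?case by (auto simp: indicator_def intro: ennreal_leI)
    qed
    show "AE x in lebesgue. (\<lambda>n. ennreal (norm (indicator (cball 0 (R+1)) x *\<^sub>R (f x - g n x)))) \<longlonglongrightarrow> 0"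
      using lim
    proof eventually_elim
      case (elim x)
      have "(\<lambda>n. norm (indicator (cball 0 (R+1)) x *\<^sub>R (f x - g n x))) \<longlonglongrightarrow>
         norm (indicator (cball 0 (R+1)) x *\<^sub>R (f x - f x))"
        by (intro tendsto_intros elim)
      from tendsto_ennrealI[OF this] show ?case by simp
    qed
  qed simp
  then have "\<forall>\<^sub>F n in sequentially. ?D n < ennreal (e/4)"
    using e by (intro order_tendstoD(2)[of _ 0]) auto
  then obtain n where n: "?D n < ennreal (e/4)"
    by (auto simp: eventually_sequentially)
  define c where "c = g n"
  define F where "F x = indicator (cball 0 (R+1)) x *\<^sub>R (f x - c x)" for x
  have Dn: "(\<integral>\<^sup>+x. ennreal (norm (F x)) \<partial>lebesgue) \<le> ennreal (e/4)"
    using n by (simp add: F_def c_def less_imp_le)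
  have Fm: "F \<in> borel_measurable lebesgue"
    unfolding F_def c_def using f gm cm by measurable
  have FB: "AE x in lebesgue. norm (F x) \<le> 2 * B"
    using B
  proof eventually_elim
    case (elim x)
    then have "norm (f x - c x) \<le> 2 * B"
      using g(2)[of n x] norm_triangle_ineq4[of "f x" "g n x"] by (simp add: c_def)
    then show ?case using B0 by (auto simp: F_def indicator_def)
  qed
  define V where "V = measure lebesgue (cball (0::real^'n) R)"
  have V: "V \<ge> 0" by (simp add: V_def)
  define e1 where "e1 = e / (2 * (V + 1))"
  have e1: "e1 > 0" "e1 * V \<le> e / 2" using e V by (auto simp: e1_def field_simps)
  have "uniformly_continuous_on (cball 0 (R+1)) c"
    using g(1)[of n] by (metis c_def compact_cball compact_uniformly_continuous continuous_on_subset subset_UNIV)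
  then obtain d0 where d0: "d0 > 0" "\<And>x y. x \<in> cball 0 (R+1) \<Longrightarrow> y \<in> cball 0 (R+1) \<Longrightarrow> dist x y < d0
      \<Longrightarrow> dist (c x) (c y) < e1"
    using e1(1) unfolding uniformly_continuous_on_def by (metis dist_commute)
  \<comment> \<open>For \<open>r < 1\<close> and \<open>x\<close> in the ball of radius \<open>R\<close>, mollification at \<open>x\<close> only sees the ball of radius \<open>R + 1\<close>,
    on which \<open>c\<close> is uniformly continuous and close to \<open>f\<close>.\<close>
  show ?thesis
  proof (rule that[of "min d0 1"])
    show "min d0 1 > 0" using d0 by simp
    fix r assume r: "0 < r" "r < min d0 1"
    have mz: "mollifier r (x - y) = 0" if "norm (x - y) > r" for x y :: "real^'n"
      using that r by (intro mollifier_eq_0) auto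
    note K = compact_cball[of 0 r] continuous_mollifier mollifier_eq_0[OF r(1)]
    have intc: "integrable lebesgue (\<lambda>y. mollifier r (x - y) *\<^sub>R c y)" for x
      by (rule integrable_conv[OF _ K]) (auto simp: c_def intro: L1_loc_continuous g)
    have intF: "integrable lebesgue (\<lambda>y. mollifier r (x - y) *\<^sub>R F y)" for x
      by (rule integrable_conv[OF L1_loc_bounded[OF Fm FB] K])
    have key: "norm (conv (mollifier r) f x - f x) \<le> norm (conv (mollifier r) F x) + e1 + norm (F x)"
      if x: "x \<in> cball 0 R" for x
    proof -
      have near: "y \<in> cball 0 (R+1)" if "norm (x - y) \<le> r" for y
        using norm_triangle_ineq2[of y x] that x r by (auto simp: norm_minus_commute)
      have "conv (mollifier r) f x = (LINT y|lebesgue. mollifier r (x - y) *\<^sub>R F y + mollifier r (x - y) *\<^sub>R c y)"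
        unfolding conv_def
      proof (rule Bochner_Integration.integral_cong[OF refl])
        fix y
        have "F y + c y = f y" if "norm (x - y) \<le> r"
          using near[OF that] by (simp add: F_def)
        then show "mollifier r (x - y) *\<^sub>R f y = mollifier r (x - y) *\<^sub>R F y + mollifier r (x - y) *\<^sub>R c y"
          using mz[of x y]
          by (cases "norm (x - y) \<le> r") (simp_all flip: scaleR_add_right)
      qed
      also have "\<dots> = conv (mollifier r) F x + conv (mollifier r) c x"
        unfolding conv_def by (rule Bochner_Integration.integral_add[OF intF[of x] intc[of x]])
      finally have split: "conv (mollifier r) f x = conv (mollifier r) F x + conv (mollifier r) c x" .
      have one: "has_bochner_integral lebesgue (\<lambda>y. mollifier r (x - y) *\<^sub>R c x) (1 *\<^sub>R c x)"
        by (intro has_bochner_integral_scaleR_left has_bochner_integral_mollifier r)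
      have cdiff: "conv (mollifier r) c x - c x = conv (mollifier r) (\<lambda>y. c y - c x) x"
        using has_bochner_integral_integral_eq
            [OF has_bochner_integral_diff[OF has_bochner_integral_integrable[OF intc[of x]] one]]
        unfolding conv_def scaleR_diff_right scaleR_one by (rule sym)
      have "ennreal (norm (conv (mollifier r) c x - c x)) \<le> (\<integral>\<^sup>+y. ennreal (mollifier r (x - y)) * ennreal (norm (c y - c x)) \<partial>lebesgue)"
        unfolding cdiff by (rule norm_conv_le)
      also have "\<dots> \<le> (\<integral>\<^sup>+y. ennreal (mollifier r (x - y)) * ennreal e1 \<partial>lebesgue)"
      proof (rule nn_integral_mono)
        fix y
        show "ennreal (mollifier r (x - y)) * ennreal (norm (c y - c x)) \<le> ennreal (mollifier r (x - y)) * ennreal e1"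
        proof (cases "norm (x - y) \<le> r")
          case True
          have "dist (c y) (c x) < e1"
            using near[OF True] near[of x] r True by (intro d0(2)) (auto simp: dist_norm norm_minus_commute)
          then show ?thesis by (intro mult_left_mono) (auto simp: dist_norm intro: ennreal_leI)
        next
          case False
          then show ?thesis using mz[of x y] by simp
        qed
      qed
      also have "\<dots> = ennreal e1"
        by (simp add: nn_integral_completion nn_integral_multc nn_integral_mollifier_shift[OF r(1)])
      finally have le: "norm (conv (mollifier r) c x - c x) \<le> e1" using e1 by simp
      have "conv (mollifier r) f x - f x = conv (mollifier r) F x + (conv (mollifier r) c x - c x) - F x"
        using x by (simp add: split F_def)
      also have "norm \<dots> \<le> norm (conv (mollifier r) F x) + norm (conv (mollifier r) c x - c x) + norm (F x)"
        by (meson add_right_mono norm_triangle_ineq norm_triangle_ineq4 order_trans)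
      finally show ?thesis using le by linarith
    qed
    have Cm: "conv (mollifier r) F \<in> borel_measurable lebesgue"
      by (intro borel_measurable_lebesgue_continuous continuous_on_conv[OF L1_loc_bounded[OF Fm FB] K])
    have "(\<integral>\<^sup>+x. ennreal (norm (conv (mollifier r) f x - f x)) * indicator (cball 0 R) x \<partial>lebesgue)
      \<le> (\<integral>\<^sup>+x. ennreal (norm (conv (mollifier r) F x)) + ennreal e1 * indicator (cball 0 R) x + ennreal (norm (F x)) \<partial>lebesgue)"
    proof (rule nn_integral_mono)
      fix x
      show "ennreal (norm (conv (mollifier r) f x - f x)) * indicator (cball 0 R) x
         \<le> ennreal (norm (conv (mollifier r) F x)) + ennreal e1 * indicator (cball 0 R) x + ennreal (norm (F x))"
      proof (cases "x \<in> cball 0 R")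
        case True
        then show ?thesis using key[OF True] e1 by (simp flip: ennreal_plus)
      qed simp
    qed
    also have "\<dots> = (\<integral>\<^sup>+x. ennreal (norm (conv (mollifier r) F x)) \<partial>lebesgue) + ennreal e1 * emeasure lebesgue (cball (0::real^'n) R)
         + (\<integral>\<^sup>+x. ennreal (norm (F x)) \<partial>lebesgue)"
    proof -
      have m: "(\<lambda>x. ennreal (norm (conv (mollifier r) F x))) \<in> borel_measurable lebesgue"
        "(\<lambda>x. ennreal e1 * indicator (cball (0::real^'n) R) x) \<in> borel_measurable lebesgue"
        "(\<lambda>x. ennreal (norm (F x))) \<in> borel_measurable lebesgue"
        using Cm Fm cm by measurable
      show ?thesis
        by (simp only: nn_integral_add[OF borel_measurable_add[OF m(1,2)] m(3)] nn_integral_add[OF m(1,2)]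
            nn_integral_cmult_indicator[OF cm])
    qed
    also have "\<dots> \<le> ennreal (e/4) + ennreal e1 * emeasure lebesgue (cball (0::real^'n) R) + ennreal (e/4)"
      using nn_integral_conv_le[OF Fm r(1)] Dn by (intro add_mono) auto
    also have "emeasure lebesgue (cball (0::real^'n) R) = ennreal V"
      unfolding V_def by (rule emeasure_eq_measure2) (metis lmeasurable_cball)
    also have "ennreal (e/4) + ennreal e1 * ennreal V + ennreal (e/4) = ennreal (e/4 + e1 * V + e/4)"
      using e e1 V by (simp flip: ennreal_plus ennreal_mult)
    also have "\<dots> \<le> ennreal e"
      using e1 by (intro ennreal_leI) auto
    finally show "(\<integral>\<^sup>+x. ennreal (norm (conv (mollifier r) f x - f x)) * indicator (cball 0 R) x \<partial>lebesgue) \<le> ennreal e" .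
  qed
qed

lemma conv_tendsto_L1:
  fixes f :: "real^'n \<Rightarrow> 'b::euclidean_space"
  assumes f: "f \<in> borel_measurable lebesgue" and B: "AE x in lebesgue. norm (f x) \<le> B"
    and r: "\<And>k. \<rho> k > 0" "\<rho> \<longlonglongrightarrow> 0"
  shows "(\<lambda>k. \<integral>\<^sup>+x. ennreal (norm (conv (mollifier (\<rho> k)) f x - f x)) * indicator (cball 0 R) x \<partial>lebesgue) \<longlonglongrightarrow> 0"
proof (rule order_tendstoI)
  fix a :: ennreal assume "0 < a"
  then obtain y where "0 < y" "y < a" using dense by blast
  then obtain e where e: "e > 0" "ennreal e < a" by (cases y) auto
  obtain d where d: "d > 0" "\<And>r. 0 < r \<Longrightarrow> r < d \<Longrightarrow>
    (\<integral>\<^sup>+x. ennreal (norm (conv (mollifier r) f x - f x)) * indicator (cball 0 R) x \<partial>lebesgue) \<le> ennreal e"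
    using conv_L1_approx[OF f B e(1), of R] by blast
  have "\<forall>\<^sub>F k in sequentially. \<rho> k < d"
    using r(2) d(1) by (rule order_tendstoD(2))
  then show "\<forall>\<^sub>F k in sequentially. (\<integral>\<^sup>+x. ennreal (norm (conv (mollifier (\<rho> k)) f x - f x)) * indicator (cball 0 R) x \<partial>lebesgue) < a"
    by eventually_elim (use d(2) r(1) e(2) in \<open>auto intro: le_less_trans\<close>)
qed simp

text \<open>
  For bounded functions the square of the error is at most a constant times the error itself, so
  convergence in \<open>L\<^sup>2\<close> follows from convergence in \<open>L\<^sup>1\<close>.
\<close>

lemma conv_tendsto_L2:
  fixes f :: "real^'n \<Rightarrow> 'b::euclidean_space"
  assumes f: "f \<in> borel_measurable lebesgue" and B: "AE x in lebesgue. norm (f x) \<le> B"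
    and r: "\<And>k. \<rho> k > 0" "\<rho> \<longlonglongrightarrow> 0" and \<Omega>: "\<Omega> \<in> sets lebesgue" "\<Omega> \<subseteq> cball 0 R"
  shows "(\<lambda>k. LINT x|lebesgue_on \<Omega>. (norm (f x - conv (mollifier (\<rho> k)) f x))\<^sup>2) \<longlonglongrightarrow> 0"
proof -
  have B0: "B \<ge> 0" using AE_bound_nonneg[OF B] .
  let ?I = "\<lambda>k. \<integral>\<^sup>+x. ennreal (norm (conv (mollifier (\<rho> k)) f x - f x)) * indicator (cball 0 R) x \<partial>lebesgue"
  have "(\<lambda>k. ennreal (2 * B) * ?I k) \<longlonglongrightarrow> ennreal 0"
    using ennreal_tendsto_cmult[OF ennreal_less_top conv_tendsto_L1[OF f B r]] by simp
  then have lim: "(\<lambda>k. enn2real (ennreal (2 * B) * ?I k)) \<longlonglongrightarrow> 0"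
    by (rule tendsto_enn2real) simp
  have Cm: "conv (mollifier (\<rho> k)) f \<in> borel_measurable lebesgue" for k
    by (intro borel_measurable_lebesgue_continuous
         continuous_on_conv[OF L1_loc_bounded[OF f B] compact_cball continuous_mollifier mollifier_eq_0[OF r(1)]])
  have fin: "\<forall>\<^sub>F k in sequentially. ?I k < 1"
    by (rule order_tendstoD(2)[OF conv_tendsto_L1[OF f B r]]) simp
  show ?thesis
  proof (rule tendsto_sandwich[OF _ _ tendsto_const])
    show "\<forall>\<^sub>F k in sequentially. 0 \<le> (LINT x|lebesgue_on \<Omega>. (norm (f x - conv (mollifier (\<rho> k)) f x))\<^sup>2)"
      by (intro always_eventually allI integral_nonneg_AE) auto
    show "\<forall>\<^sub>F k in sequentially. (LINT x|lebesgue_on \<Omega>. (norm (f x - conv (mollifier (\<rho> k)) f x))\<^sup>2)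
       \<le> enn2real (ennreal (2 * B) * ?I k)"
      using fin
    proof eventually_elim
      case (elim k)
      have m: "(\<lambda>x. (norm (f x - conv (mollifier (\<rho> k)) f x))\<^sup>2) \<in> borel_measurable lebesgue"
        using f Cm[of k] by measurable
      have "(LINT x|lebesgue_on \<Omega>. (norm (f x - conv (mollifier (\<rho> k)) f x))\<^sup>2)
         = enn2real (\<integral>\<^sup>+x. ennreal ((norm (f x - conv (mollifier (\<rho> k)) f x))\<^sup>2) \<partial>lebesgue_on \<Omega>)"
        using m by (intro integral_eq_nn_integral) (auto simp: measurable_restrict_space1)
      also have "\<dots> \<le> enn2real (ennreal (2 * B) * ?I k)"
      proof (rule enn2real_mono)
        have "(\<integral>\<^sup>+x. ennreal ((norm (f x - conv (mollifier (\<rho> k)) f x))\<^sup>2) \<partial>lebesgue_on \<Omega>)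
          = (\<integral>\<^sup>+x. ennreal ((norm (f x - conv (mollifier (\<rho> k)) f x))\<^sup>2) * indicator \<Omega> x \<partial>lebesgue)"
          using \<Omega> by (simp add: nn_integral_restrict_space)
        also have "\<dots> \<le> (\<integral>\<^sup>+x. ennreal (2 * B) * (ennreal (norm (conv (mollifier (\<rho> k)) f x - f x)) * indicator (cball 0 R) x) \<partial>lebesgue)"
        proof (rule nn_integral_mono_AE, rule AE_mp[OF B], rule AE_I2, rule impI)
          fix x assume fx: "norm (f x) \<le> B"
          have "norm (f x - conv (mollifier (\<rho> k)) f x) \<le> 2 * B"
            using norm_triangle_ineq4[of "f x" "conv (mollifier (\<rho> k)) f x"] fx norm_conv_bound[OF B r(1), of k x]
            by linarith
          then have "(norm (f x - conv (mollifier (\<rho> k)) f x))\<^sup>2 \<le> 2 * B * norm (conv (mollifier (\<rho> k)) f x - f x)"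
            by (simp add: power2_eq_square norm_minus_commute mult_right_mono)
          then have "ennreal ((norm (f x - conv (mollifier (\<rho> k)) f x))\<^sup>2) \<le> ennreal (2 * B) * ennreal (norm (conv (mollifier (\<rho> k)) f x - f x))"
            using B0 by (simp flip: ennreal_mult)
          then show "ennreal ((norm (f x - conv (mollifier (\<rho> k)) f x))\<^sup>2) * indicator \<Omega> x
            \<le> ennreal (2 * B) * (ennreal (norm (conv (mollifier (\<rho> k)) f x - f x)) * indicator (cball 0 R) x)"
            using \<Omega>(2) by (auto simp: indicator_def)
        qed
        also have "\<dots> = ennreal (2 * B) * ?I k"
        proof (rule nn_integral_cmult)
          have "cball (0::real^'n) R \<in> sets lebesgue" by (simp add: fmeasurableD)
          then show "(\<lambda>x. ennreal (norm (conv (mollifier (\<rho> k)) f x - f x)) * indicator (cball 0 R) x) \<in> borel_measurable lebesgue"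
            using f Cm[of k] by measurable
        qed
        finally show "(\<integral>\<^sup>+x. ennreal ((norm (f x - conv (mollifier (\<rho> k)) f x))\<^sup>2) \<partial>lebesgue_on \<Omega>) \<le> ennreal (2 * B) * ?I k" .
        show "ennreal (2 * B) * ?I k < top"
          using elim by (auto simp: ennreal_mult_less_top intro: less_trans)
      qed
      finally show ?case .
    qed
    show "(\<lambda>k. enn2real (ennreal (2 * B) * ?I k)) \<longlonglongrightarrow> 0" by (rule lim)
  qed
qed


section \<open>Calculus of weak gradients\<close>

lemma integral_lebesgue_on_eq:
  fixes f :: "'a::euclidean_space \<Rightarrow> 'b::euclidean_space"
  assumes "\<Omega> \<in> sets lebesgue" "\<And>x. x \<notin> \<Omega> \<Longrightarrow> f x = 0"
  shows "(LINT x|lebesgue_on \<Omega>. f x) = (LINT x|lebesgue. f x)"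
proof -
  have "(LINT x|lebesgue_on \<Omega>. f x) = (LINT x|lebesgue. indicator \<Omega> x *\<^sub>R f x)"
    using assms by (intro integral_restrict_space) auto
  also have "\<dots> = (LINT x|lebesgue. f x)"
    using assms by (intro Bochner_Integration.integral_cong) (auto simp: indicator_def)
  finally show ?thesis .
qed

text \<open>
  A test function and its gradient vanish off the domain, so all integrals may be taken over the whole
  space; this makes weak gradients on different domains comparable.
\<close>

lemma has_weak_gradient_iff:
  assumes "\<Omega> \<in> sets lebesgue"
  shows "has_weak_gradient \<Omega> u G \<longleftrightarrow> L1_loc \<Omega> u \<and> L1_loc \<Omega> G \<and>
    (\<forall>\<phi> :: real^'n \<Rightarrow> real. test_fun \<Omega> \<phi> \<longrightarrow> (\<forall>i j.
        (LINT x|lebesgue. u x $ j * grad \<phi> x $ i) = - (LINT x|lebesgue. G x $ j $ i * \<phi> x)))"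
proof -
  have "(LINT x|lebesgue_on \<Omega>. u x $ j * grad \<phi> x $ i) = (LINT x|lebesgue. u x $ j * grad \<phi> x $ i)"
    "(LINT x|lebesgue_on \<Omega>. G x $ j $ i * \<phi> x) = (LINT x|lebesgue. G x $ j $ i * \<phi> x)"
    if \<phi>: "test_fun \<Omega> \<phi>" for \<phi> i j
  proof -
    obtain K where K': "C1_on UNIV \<phi>" "compact K" "K \<subseteq> \<Omega>" "\<forall>x. x \<notin> K \<longrightarrow> \<phi> x = 0"
      by (rule test_funE[OF \<phi>])
    note K = K'(2,3) K'(4)[rule_format]
    have "grad \<phi> x = 0" if "x \<notin> \<Omega>" for x
      by (rule grad_eq_0_outside[of K]) (use K that compact_imp_closed in auto)
    then show "(LINT x|lebesgue_on \<Omega>. u x $ j * grad \<phi> x $ i) = (LINT x|lebesgue. u x $ j * grad \<phi> x $ i)"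
      "(LINT x|lebesgue_on \<Omega>. G x $ j $ i * \<phi> x) = (LINT x|lebesgue. G x $ j $ i * \<phi> x)"
      using K by (intro integral_lebesgue_on_eq assms; auto)+
  qed
  then show ?thesis unfolding has_weak_gradient_def by (auto cong: conj_cong)
qed

lemma has_weak_gradient_subset:
  assumes "has_weak_gradient UNIV u G" "\<Omega> \<in> sets lebesgue"
  shows "has_weak_gradient \<Omega> u G"
proof -
  have "test_fun \<Omega> \<phi> \<Longrightarrow> test_fun UNIV \<phi>" for \<phi> :: "real^'a \<Rightarrow> real"
    by (auto simp: test_fun_def)
  then show ?thesis
    using assms has_weak_gradient_iff[of UNIV u G] unfolding has_weak_gradient_iff[OF assms(2)]
    by (auto simp: L1_loc_def)
qed

lemma test_fun_integrable:
  fixes f :: "real^'n \<Rightarrow> 'b::euclidean_space" and \<phi> :: "real^'n \<Rightarrow> real"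
  assumes f: "L1_loc \<Omega> f" and \<phi>: "test_fun \<Omega> \<phi>"
  shows "integrable lebesgue (\<lambda>x. \<phi> x *\<^sub>R f x)" "integrable lebesgue (\<lambda>x. grad \<phi> x $ i *\<^sub>R f x)"
proof -
  obtain K where K': "C1_on UNIV \<phi>" "compact K" "K \<subseteq> \<Omega>" "\<forall>x. x \<notin> K \<longrightarrow> \<phi> x = 0"
    by (rule test_funE[OF \<phi>])
  note K = K'(1-3) K'(4)[rule_format]
  show "integrable lebesgue (\<lambda>x. \<phi> x *\<^sub>R f x)"
    by (rule integrable_continuous_support_scaleR[OF f K(2,3) C1_on_continuous[OF K(1)] K(4)])
  show "integrable lebesgue (\<lambda>x. grad \<phi> x $ i *\<^sub>R f x)"
  proof (rule integrable_continuous_support_scaleR[OF f K(2,3)])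
    show "continuous_on UNIV (\<lambda>x. grad \<phi> x $ i)"
      by (intro continuous_intros C1_on_continuous_grad K)
    show "grad \<phi> x $ i = 0" if "x \<notin> K" for x
      by (simp add: grad_eq_0_outside[OF compact_imp_closed[OF K(2)] K(4) that])
  qed
qed

lemma integrable_vec_nth:
  fixes f :: "'a \<Rightarrow> 'b::euclidean_space ^'m"
  shows "integrable M f \<Longrightarrow> integrable M (\<lambda>x. f x $ j)"
  by (rule integrable_bounded_linear[OF bounded_linear_vec_nth])

lemma integral_vec_nth:
  fixes f :: "'a \<Rightarrow> 'b::euclidean_space ^'m"
  shows "integrable M f \<Longrightarrow> (LINT x|M. f x $ j) = (LINT x|M. f x) $ j"
  by (rule integral_bounded_linear[OF bounded_linear_vec_nth])

lemma weak_gradient_integrable: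
  fixes u :: "real^'n \<Rightarrow> real^'m" and G :: "real^'n \<Rightarrow> real^'n^'m" and \<phi> :: "real^'n \<Rightarrow> real"
  assumes "test_fun \<Omega> \<phi>"
  shows "L1_loc \<Omega> u \<Longrightarrow> integrable lebesgue (\<lambda>x. u x $ j * grad \<phi> x $ i)"
    and "L1_loc \<Omega> G \<Longrightarrow> integrable lebesgue (\<lambda>x. G x $ j $ i * \<phi> x)"
  using integrable_vec_nth[OF test_fun_integrable(2)[OF _ assms], of u i j]
    integrable_vec_nth[OF integrable_vec_nth[OF test_fun_integrable(1)[OF _ assms], of G j], of i]
  by (simp_all add: mult.commute)

lemma L1_loc_add:
  "L1_loc \<Omega> f \<Longrightarrow> L1_loc \<Omega> g \<Longrightarrow> L1_loc \<Omega> (\<lambda>x. f x + g x)"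
  by (simp add: L1_loc_iff scaleR_add_right)

lemma L1_loc_diff:
  "L1_loc \<Omega> f \<Longrightarrow> L1_loc \<Omega> g \<Longrightarrow> L1_loc \<Omega> (\<lambda>x. f x - g x)"
  by (simp add: L1_loc_iff scaleR_diff_right)

lemma has_weak_gradient_add:
  assumes u: "has_weak_gradient \<Omega> u G" and v: "has_weak_gradient \<Omega> v H" and \<Omega>: "\<Omega> \<in> sets lebesgue"
  shows "has_weak_gradient \<Omega> (\<lambda>x. u x + v x) (\<lambda>x. G x + H x)"
  unfolding has_weak_gradient_iff[OF \<Omega>]
proof (intro conjI allI impI)
  note u' = u[unfolded has_weak_gradient_iff[OF \<Omega>]] and v' = v[unfolded has_weak_gradient_iff[OF \<Omega>]]
  show "L1_loc \<Omega> (\<lambda>x. u x + v x)" "L1_loc \<Omega> (\<lambda>x. G x + H x)"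
    using u' v' by (simp_all add: L1_loc_add)
  fix \<phi> :: "real^'a \<Rightarrow> real" and i j assume \<phi>: "test_fun \<Omega> \<phi>"
  have int: "integrable lebesgue (\<lambda>x. u x $ j * grad \<phi> x $ i)" "integrable lebesgue (\<lambda>x. v x $ j * grad \<phi> x $ i)"
    "integrable lebesgue (\<lambda>x. G x $ j $ i * \<phi> x)" "integrable lebesgue (\<lambda>x. H x $ j $ i * \<phi> x)"
    using u' v' by (intro weak_gradient_integrable[OF \<phi>]; blast)+
  have eq: "(LINT x|lebesgue. u x $ j * grad \<phi> x $ i) = - (LINT x|lebesgue. G x $ j $ i * \<phi> x)"
    "(LINT x|lebesgue. v x $ j * grad \<phi> x $ i) = - (LINT x|lebesgue. H x $ j $ i * \<phi> x)"
    using u' v' \<phi> by blast+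
  show "(LINT x|lebesgue. (u x + v x) $ j * grad \<phi> x $ i) =
      - (LINT x|lebesgue. (G x + H x) $ j $ i * \<phi> x)"
    unfolding vector_add_component distrib_right Bochner_Integration.integral_add[OF int(1,2)]
      Bochner_Integration.integral_add[OF int(3,4)] eq by simp
qed

lemma has_weak_gradient_diff:
  assumes u: "has_weak_gradient \<Omega> u G" and v: "has_weak_gradient \<Omega> v H" and \<Omega>: "\<Omega> \<in> sets lebesgue"
  shows "has_weak_gradient \<Omega> (\<lambda>x. u x - v x) (\<lambda>x. G x - H x)"
  unfolding has_weak_gradient_iff[OF \<Omega>]
proof (intro conjI allI impI)
  note u' = u[unfolded has_weak_gradient_iff[OF \<Omega>]] and v' = v[unfolded has_weak_gradient_iff[OF \<Omega>]]
  show "L1_loc \<Omega> (\<lambda>x. u x - v x)" "L1_loc \<Omega> (\<lambda>x. G x - H x)"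
    using u' v' by (simp_all add: L1_loc_diff)
  fix \<phi> :: "real^'a \<Rightarrow> real" and i j assume \<phi>: "test_fun \<Omega> \<phi>"
  have int: "integrable lebesgue (\<lambda>x. u x $ j * grad \<phi> x $ i)" "integrable lebesgue (\<lambda>x. v x $ j * grad \<phi> x $ i)"
    "integrable lebesgue (\<lambda>x. G x $ j $ i * \<phi> x)" "integrable lebesgue (\<lambda>x. H x $ j $ i * \<phi> x)"
    using u' v' by (intro weak_gradient_integrable[OF \<phi>]; blast)+
  have eq: "(LINT x|lebesgue. u x $ j * grad \<phi> x $ i) = - (LINT x|lebesgue. G x $ j $ i * \<phi> x)"
    "(LINT x|lebesgue. v x $ j * grad \<phi> x $ i) = - (LINT x|lebesgue. H x $ j $ i * \<phi> x)"
    using u' v' \<phi> by blast+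
  show "(LINT x|lebesgue. (u x - v x) $ j * grad \<phi> x $ i) =
      - (LINT x|lebesgue. (G x - H x) $ j $ i * \<phi> x)"
    unfolding vector_minus_component left_diff_distrib Bochner_Integration.integral_diff[OF int(1,2)]
      Bochner_Integration.integral_diff[OF int(3,4)] eq by simp
qed

lemma integral_lebesgue_reflect:
  fixes f :: "real^'n \<Rightarrow> real"
  assumes "continuous_on UNIV f"
  shows "(LINT y|lebesgue. f (x - y)) = (LINT y|lebesgue. f y)"
proof -
  have m[measurable]: "f \<in> borel_measurable borel" using assms by (rule borel_measurable_continuous_onI)
  have eq: "(lborel :: (real^'n) measure) = distr lborel borel (\<lambda>y. x - y)"
    using lborel_affine[of "-1" x] by (simp add: density_1)
  have "(LINT y|lborel. f y) = (LINT y|distr lborel borel (\<lambda>y. x - y). f y)"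
    using eq by simp
  also have "\<dots> = (LINT y|lborel. f (x - y))"
    by (rule integral_distr) auto
  finally show ?thesis by (simp add: integral_completion)
qed

text \<open>
  Integrating by parts against the constant \<open>1\<close>: the convolution of a test function with \<open>1\<close> is constant,
  and its derivative is the convolution of the gradient with \<open>1\<close>.
\<close>

lemma integral_grad_test_fun:
  fixes \<phi> :: "real^'n \<Rightarrow> real"
  assumes \<phi>: "test_fun \<Omega> \<phi>"
  shows "(LINT x|lebesgue. grad \<phi> x $ i) = 0"
proof -
  obtain K where K': "C1_on UNIV \<phi>" "compact K" "K \<subseteq> \<Omega>" "\<forall>x. x \<notin> K \<longrightarrow> \<phi> x = 0"
    by (rule test_funE[OF \<phi>])
  note K = K'(1-3) K'(4)[rule_format]
  have one: "L1_loc UNIV (\<lambda>x::real^'n. 1::real)" by (intro L1_loc_continuous continuous_on_const)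
  have const: "conv \<phi> (\<lambda>_. 1::real) = (\<lambda>_. LINT y|lebesgue. \<phi> y)"
    unfolding conv_def using integral_lebesgue_reflect[OF C1_on_continuous[OF K(1)]] by auto
  have "(\<lambda>h. conv (\<lambda>z. h \<bullet> grad \<phi> z) (\<lambda>_. 1::real) 0) = (\<lambda>h. 0)"
    using has_derivative_conv[OF one K(2,1,4), of 0] unfolding const
    by (rule has_derivative_unique[OF _ has_derivative_const])
  from fun_cong[OF this, of "axis i 1"]
  have "(LINT y|lebesgue. grad \<phi> (0 - y) $ i) = 0"
    by (simp add: conv_def inner_axis' del: diff_0)
  then show ?thesis
    using integral_lebesgue_reflect[of "\<lambda>y. grad \<phi> y $ i" 0] C1_on_continuous_grad[OF K(1)]
    by (simp add: continuous_intros)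
qed

lemma test_fun_mult:
  fixes \<phi> \<psi> :: "real^'n \<Rightarrow> real"
  assumes \<phi>: "test_fun \<Omega> \<phi>" and \<psi>: "C1_on UNIV \<psi>"
  shows "test_fun \<Omega> (\<lambda>x. \<psi> x * \<phi> x)"
    and "grad (\<lambda>x. \<psi> x * \<phi> x) x = \<psi> x *\<^sub>R grad \<phi> x + \<phi> x *\<^sub>R grad \<psi> x"
proof -
  obtain K where K': "C1_on UNIV \<phi>" "compact K" "K \<subseteq> \<Omega>" "\<forall>x. x \<notin> K \<longrightarrow> \<phi> x = 0"
    by (rule test_funE[OF \<phi>])
  note K = K'(1-3) K'(4)[rule_format]
  have g: "GDERIV (\<lambda>x. \<psi> x * \<phi> x) x :> \<psi> x *\<^sub>R grad \<phi> x + \<phi> x *\<^sub>R grad \<psi> x" for x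
    by (rule GDERIV_mult) (auto intro: C1_on_gderiv K \<psi>)
  show "grad (\<lambda>x. \<psi> x * \<phi> x) x = \<psi> x *\<^sub>R grad \<phi> x + \<phi> x *\<^sub>R grad \<psi> x" by (rule grad_eqI[OF g])
  have "C1_on UNIV (\<lambda>x. \<psi> x * \<phi> x)"
    by (rule C1_onI_gderiv[OF g])
       (intro continuous_intros C1_on_continuous C1_on_continuous_grad K \<psi>)
  then show "test_fun \<Omega> (\<lambda>x. \<psi> x * \<phi> x)"
    by (rule test_funI[OF _ K(2,3)]) (simp add: K(4))
qed

text \<open>
  The product rule reduces integration by parts to the vanishing of the integral of the gradient of
  a test function.
\<close>

lemma has_weak_gradient_C1:
  fixes f :: "real^'n \<Rightarrow> real^'m"
  assumes der: "\<And>x. (f has_derivative (\<lambda>h. A x *v h)) (at x)" and A: "continuous_on UNIV A"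
    and \<Omega>: "\<Omega> \<in> sets lebesgue"
  shows "has_weak_gradient \<Omega> f A"
  unfolding has_weak_gradient_iff[OF \<Omega>]
proof (intro conjI allI impI)
  have cont: "continuous_on UNIV f"
    using der has_derivative_continuous continuous_at_imp_continuous_on by blast
  show L1: "L1_loc \<Omega> f" "L1_loc \<Omega> A" using cont A by (simp_all add: L1_loc_continuous)
  fix \<phi> :: "real^'n \<Rightarrow> real" and i j assume \<phi>: "test_fun \<Omega> \<phi>"
  have g: "GDERIV (\<lambda>x. f x $ j) x :> A x $ j" for x
    unfolding gderiv_def using bounded_linear.has_derivative[OF bounded_linear_vec_nth der[of x], of j]
    by (simp add: matrix_vector_mult_def inner_vec_def mult.commute)
  have C1: "C1_on UNIV (\<lambda>x. f x $ j)"
    by (rule C1_onI_gderiv[OF g]) (intro continuous_intros A)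
  have "0 = (LINT x|lebesgue. grad (\<lambda>x. f x $ j * \<phi> x) x $ i)"
    using integral_grad_test_fun[OF test_fun_mult(1)[OF \<phi> C1]] by simp
  also have "\<dots> = (LINT x|lebesgue. f x $ j * grad \<phi> x $ i + A x $ j $ i * \<phi> x)"
    by (simp add: test_fun_mult(2)[OF \<phi> C1] grad_eqI[OF g]) (simp add: mult.commute)
  also have "\<dots> = (LINT x|lebesgue. f x $ j * grad \<phi> x $ i) + (LINT x|lebesgue. A x $ j $ i * \<phi> x)"
    by (intro Bochner_Integration.integral_add weak_gradient_integrable[OF \<phi>] L1)
  finally show "(LINT x|lebesgue. f x $ j * grad \<phi> x $ i) = - (LINT x|lebesgue. A x $ j $ i * \<phi> x)"
    by simp
qed

text \<open>
  Mollification commutes with differentiation: the reflected and translated kernel is itself a test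
  function, so the definition of the weak gradient moves the derivative from the kernel to \<open>v\<close>.
\<close>

lemma has_derivative_conv_weak_gradient:
  fixes v :: "real^'n \<Rightarrow> real^'m"
  assumes v: "has_weak_gradient UNIV v G" and K: "compact K" "C1_on UNIV \<phi>" "\<And>x. x \<notin> K \<Longrightarrow> \<phi> x = 0"
  shows "(conv \<phi> v has_derivative (\<lambda>h. conv \<phi> G x *v h)) (at x)"
proof -
  have L1: "L1_loc UNIV v" "L1_loc UNIV G" using v by (simp_all add: has_weak_gradient_def)
  have g0: "grad \<phi> z = 0" if "z \<notin> K" for z
    by (rule grad_eq_0_outside[of K]) (use K that compact_imp_closed in auto)
  define \<eta> where "\<eta> y = \<phi> (x - y)" for y
  have g: "GDERIV \<eta> y :> - grad \<phi> (x - y)" for y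
  proof -
    have "(\<phi> has_derivative (\<lambda>h. h \<bullet> grad \<phi> (x - y))) (at (x - y))"
      using C1_on_gderiv[OF K(2)] by (simp add: gderiv_def)
    from has_derivative_compose[of "\<lambda>y. x - y" "\<lambda>h. - h" y UNIV, OF _ this]
    show ?thesis unfolding gderiv_def \<eta>_def by (simp add: has_derivative_diff[of "\<lambda>_. x" "\<lambda>_. 0" _ "\<lambda>y. y" "\<lambda>y. y", simplified])
  qed
  have \<eta>: "test_fun UNIV \<eta>"
  proof (rule test_funI)
    show "C1_on UNIV \<eta>"
      by (rule C1_onI_gderiv[OF g])
         (intro continuous_intros continuous_on_compose2[OF C1_on_continuous_grad[OF K(2)]], auto)
    show "compact ((\<lambda>y. x - y) ` K)" using K(1) by (rule compact_shift)
    show "\<eta> y = 0" if "y \<notin> (\<lambda>y. x - y) ` K" for y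
      unfolding \<eta>_def using that image_eqI[of y "\<lambda>y. x - y" "x - y" K] by (intro K(3)) auto
  qed auto
  have eq: "conv (\<lambda>z. h \<bullet> grad \<phi> z) v x = conv \<phi> G x *v h" for h
  proof (simp add: vec_eq_iff, rule allI)
    fix j
    have int: "integrable lebesgue (\<lambda>y. (h \<bullet> grad \<phi> (x - y)) *\<^sub>R v y)"
      by (rule integrable_conv[OF L1(1) K(1), of "\<lambda>z. h \<bullet> grad \<phi> z"])
         (auto intro!: continuous_intros C1_on_continuous_grad[OF K(2)] simp: g0)
    have intG: "integrable lebesgue (\<lambda>y. \<phi> (x - y) *\<^sub>R G y)"
      by (rule integrable_conv[OF L1(2) K(1) C1_on_continuous[OF K(2)] K(3)])
    have w: "(LINT y|lebesgue. v y $ j * grad \<phi> (x - y) $ i) = (LINT y|lebesgue. G y $ j $ i * \<phi> (x - y))" for i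
    proof -
      have "(LINT y|lebesgue. v y $ j * grad \<eta> y $ i) = - (LINT y|lebesgue. G y $ j $ i * \<eta> y)"
        using v \<eta> by (simp add: has_weak_gradient_iff)
      then show ?thesis by (simp add: grad_eqI[OF g] \<eta>_def)
    qed
    have iv: "integrable lebesgue (\<lambda>y. v y $ j * grad \<phi> (x - y) $ i)" for i
      using weak_gradient_integrable(1)[OF \<eta> L1(1), of j i] by (simp add: grad_eqI[OF g])
    have "conv (\<lambda>z. h \<bullet> grad \<phi> z) v x $ j = (LINT y|lebesgue. (h \<bullet> grad \<phi> (x - y)) * v y $ j)"
      using integral_vec_nth[OF int, of j] by (simp add: conv_def)
    also have "\<dots> = (LINT y|lebesgue. (\<Sum>i\<in>UNIV. h $ i * (v y $ j * grad \<phi> (x - y) $ i)))"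
      by (simp add: inner_vec_def sum_distrib_left sum_distrib_right mult_ac)
    also have "\<dots> = (\<Sum>i\<in>UNIV. h $ i * (LINT y|lebesgue. v y $ j * grad \<phi> (x - y) $ i))"
      using iv by (subst Bochner_Integration.integral_sum) auto
    also have "\<dots> = (\<Sum>i\<in>UNIV. conv \<phi> G x $ j $ i * h $ i)"
    proof (rule sum.cong[OF refl])
      fix i
      have "conv \<phi> G x $ j $ i = (LINT y|lebesgue. G y $ j $ i * \<phi> (x - y))"
        using integral_vec_nth[OF intG, of j] integral_vec_nth[OF integrable_vec_nth[OF intG, of j], of i]
        by (simp add: conv_def mult.commute)
      then show "h $ i * (LINT y|lebesgue. v y $ j * grad \<phi> (x - y) $ i) = conv \<phi> G x $ j $ i * h $ i"
        by (simp add: w)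
    qed
    finally show "conv (\<lambda>z. h \<bullet> grad \<phi> z) v x $ j = (conv \<phi> G x *v h) $ j"
      by (simp add: matrix_vector_mult_def)
  qed
  show ?thesis using has_derivative_conv[OF L1(1) K, of x] unfolding eq .
qed


section \<open>Uniqueness of weak gradients\<close>

text \<open>
  The fundamental lemma of the calculus of variations.  Mollifications of the sign of \<open>g\<close> on a ball are
  test functions bounded by \<open>1\<close>, and a subsequence of them converges almost everywhere; in the limit
  orthogonality says that the integral of \<open>\<bar>g\<bar>\<close> over the ball is zero.
\<close>

lemma AE_eq_0_if_orthogonal_to_test_funs:
  fixes g :: "real^'n \<Rightarrow> real"
  assumes g: "integrable lebesgue g"
    and orth: "\<And>\<phi>. test_fun UNIV \<phi> \<Longrightarrow> (LINT x|lebesgue. g x * \<phi> x) = 0"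
  shows "AE x in lebesgue. g x = 0"
proof -
  have gm: "g \<in> borel_measurable lebesgue" using g by (rule borel_measurable_integrable)
  have "AE x in lebesgue. x \<in> cball 0 R \<longrightarrow> g x = 0" for R
  proof -
    \<comment> \<open>The sign is truncated to a ball so that its mollifications have compact support.\<close>
    define h where "h x = indicator (cball 0 R) x * sgn (g x)" for x
    have cm: "cball (0::real^'n) R \<in> sets lebesgue" for R by (simp add: fmeasurableD)
    have hm: "h \<in> borel_measurable lebesgue"
      unfolding h_def using gm cm by measurable
    have hB: "AE x in lebesgue. norm (h x) \<le> 1"
      by (rule AE_I2) (auto simp: h_def indicator_def sgn_if)
    define \<rho> :: "nat \<Rightarrow> real" where "\<rho> k = inverse (real (Suc k))" for k
    have \<rho>: "\<rho> k > 0" "\<rho> k \<le> 1" "\<rho> \<longlonglongrightarrow> 0" for k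
      using LIMSEQ_inverse_real_of_nat by (auto simp: \<rho>_def[abs_def] field_simps)
    define \<phi> where "\<phi> k = conv (mollifier (\<rho> k)) h" for k
    note hL = L1_loc_bounded[OF hm hB]
    have \<phi>C1: "C1_on UNIV (\<phi> k)" for k
      unfolding \<phi>_def by (rule C1_on_conv[OF hL compact_cball[of 0 "\<rho> k"] C1_mollifier mollifier_eq_0[OF \<rho>(1)]])
    have \<phi>m: "\<phi> k \<in> borel_measurable lebesgue" for k
      by (intro borel_measurable_lebesgue_continuous C1_on_continuous \<phi>C1)
    have \<phi>B: "norm (\<phi> k x) \<le> 1" for k x
      unfolding \<phi>_def by (rule norm_conv_bound[OF hB \<rho>(1)])
    have \<phi>0: "\<phi> k x = 0" if "x \<notin> cball 0 (R + 1)" for k x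
    proof -
      have "norm x > R + \<rho> k" using that \<rho>(2)[of k] by simp
      then show ?thesis
        unfolding \<phi>_def by (rule conv_mollifier_eq_0[OF \<rho>(1), rotated]) (simp add: h_def)
    qed
    have \<phi>t: "test_fun UNIV (\<phi> k)" for k
      by (rule test_funI[OF \<phi>C1 compact_cball[of 0 "R + 1"] _ \<phi>0]) auto
    have diff0: "\<phi> k x - h x = 0" if "x \<notin> cball 0 (R + 1)" for k x
      using \<phi>0[OF that, of k] that by (simp add: h_def)
    have dint: "integrable lebesgue (\<lambda>x. \<phi> k x - h x)" for k
    proof (rule Bochner_Integration.integrable_bound[of lebesgue "\<lambda>x. indicator (cball 0 (R+1)) x * (2::real)"])
      show "integrable lebesgue (\<lambda>x::real^'n. indicator (cball 0 (R+1)) x * (2::real))"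
        using lmeasurable_cball[of "0::real^'n" "R+1"]
        by (intro integrable_mult_left integrable_real_indicator) (auto simp: fmeasurable_def)
      show "(\<lambda>x. \<phi> k x - h x) \<in> borel_measurable lebesgue" using \<phi>m hm by measurable
      show "AE x in lebesgue. norm (\<phi> k x - h x) \<le> norm (indicator (cball 0 (R+1)) x * (2::real))"
        using hB
      proof eventually_elim
        case (elim x)
        have "norm (\<phi> k x - h x) \<le> 2"
          using \<phi>B[of k x] elim norm_triangle_ineq4[of "\<phi> k x" "h x"] by linarith
        then show ?case using diff0[of x k] by (cases "x \<in> cball 0 (R+1)") simp_all
      qed
    qed
    have "(\<lambda>k. LINT x|lebesgue. norm (\<phi> k x - h x)) \<longlonglongrightarrow> 0"
    proof -
      have "(LINT x|lebesgue. norm (\<phi> k x - h x)) =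
        enn2real (\<integral>\<^sup>+x. ennreal (norm (\<phi> k x - h x)) * indicator (cball 0 (R+1)) x \<partial>lebesgue)" for k
      proof -
        have "(LINT x|lebesgue. norm (\<phi> k x - h x)) = enn2real (\<integral>\<^sup>+x. ennreal (norm (\<phi> k x - h x)) \<partial>lebesgue)"
          by (rule integral_eq_nn_integral) (use dint[of k] in \<open>auto intro: borel_measurable_integrable\<close>)
        also have "(\<integral>\<^sup>+x. ennreal (norm (\<phi> k x - h x)) \<partial>lebesgue) =
           (\<integral>\<^sup>+x. ennreal (norm (\<phi> k x - h x)) * indicator (cball 0 (R+1)) x \<partial>lebesgue)"
        proof (rule nn_integral_cong)
          fix x show "ennreal (norm (\<phi> k x - h x)) = ennreal (norm (\<phi> k x - h x)) * indicator (cball 0 (R+1)) x"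
            using diff0[of x k] by (cases "x \<in> cball 0 (R+1)") simp_all
        qed
        finally show ?thesis .
      qed
      moreover have "(\<lambda>k. enn2real (\<integral>\<^sup>+x. ennreal (norm (\<phi> k x - h x)) * indicator (cball 0 (R+1)) x \<partial>lebesgue)) \<longlonglongrightarrow> 0"
        using conv_tendsto_L1[OF hm hB \<rho>(1) \<rho>(3), of "R+1"] unfolding \<phi>_def
        by (intro tendsto_enn2real) simp_all
      ultimately show ?thesis by simp
    qed
    from tendsto_L1_AE_subseq[OF dint this] obtain s :: "nat \<Rightarrow> nat" where
      s: "AE x in lebesgue. (\<lambda>k. \<phi> (s k) x - h x) \<longlonglongrightarrow> 0" by blast
    have "(\<lambda>k. LINT x|lebesgue. g x * \<phi> (s k) x) \<longlonglongrightarrow> (LINT x|lebesgue. g x * h x)"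
    proof (rule integral_dominated_convergence[where w="\<lambda>x. norm (g x)"])
      show "(\<lambda>x. g x * h x) \<in> borel_measurable lebesgue" "(\<lambda>x. g x * \<phi> (s k) x) \<in> borel_measurable lebesgue" for k
        using gm hm \<phi>m by measurable
      show "AE x in lebesgue. norm (g x * \<phi> (s k) x) \<le> norm (g x)" for k
        using \<phi>B by (intro AE_I2) (simp add: abs_mult mult_left_le)
      show "AE x in lebesgue. (\<lambda>k. g x * \<phi> (s k) x) \<longlonglongrightarrow> g x * h x"
        using s by eventually_elim (auto intro!: tendsto_intros simp: LIM_zero_iff)
    qed (use g in simp)
    then have "(LINT x|lebesgue. g x * h x) = 0"
      using orth[OF \<phi>t] by (simp add: LIMSEQ_const_iff)
    moreover have "g x * h x = indicator (cball 0 R) x * norm (g x)" for x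
      by (simp add: h_def sgn_if indicator_def abs_if)
    moreover have "integrable lebesgue (\<lambda>x. indicator (cball 0 R) x * norm (g x))"
      using integrable_mult_indicator[OF cm, of "\<lambda>x. norm (g x)" R] g by simp
    ultimately have "AE x in lebesgue. indicator (cball 0 R) x * norm (g x) = 0"
      using integral_nonneg_eq_0_iff_AE[of lebesgue "\<lambda>x. indicator (cball 0 R) x * norm (g x)"] by simp
    then show ?thesis by eventually_elim (auto simp: indicator_def)
  qed
  then have "AE x in lebesgue. \<forall>k::nat. x \<in> cball 0 (real k) \<longrightarrow> g x = 0"
    by (simp only: AE_all_countable) blast
  then show ?thesis
  proof eventually_elim
    case (elim x)
    obtain k where "norm x \<le> real k" using real_arch_simple by blast
    then show ?case using elim by auto
  qed
qed

text \<open>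
  An open set is covered by countably many of its balls (Lindelof), so a local almost everywhere
  statement is a global one.
\<close>

lemma AE_local:
  fixes \<Omega> :: "(real^'n) set"
  assumes \<Omega>: "open \<Omega>"
    and loc: "\<And>x r. r > 0 \<Longrightarrow> cball x r \<subseteq> \<Omega> \<Longrightarrow> AE y in lebesgue. y \<in> ball x r \<longrightarrow> P y"
  shows "AE y in lebesgue. y \<in> \<Omega> \<longrightarrow> P y"
proof -
  define F where "F = {ball x r | x r. r > 0 \<and> cball x r \<subseteq> \<Omega>}"
  have "\<And>S. S \<in> F \<Longrightarrow> open S" by (auto simp: F_def)
  then obtain F' where F': "F' \<subseteq> F" "countable F'" "\<Union>F' = \<Union>F"
    using Lindelof[of F] by blast
  have "\<Omega> \<subseteq> \<Union>F"
  proof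
    fix x assume "x \<in> \<Omega>"
    then obtain r where "r > 0" "cball x r \<subseteq> \<Omega>" using \<Omega> open_contains_cball by blast
    then show "x \<in> \<Union>F" by (auto simp: F_def intro!: exI[of _ "ball x r"])
  qed
  have "AE y in lebesgue. \<forall>S\<in>F'. y \<in> S \<longrightarrow> P y"
    unfolding AE_ball_countable[OF F'(2)]
    using F'(1) loc by (auto simp: F_def)
  then show ?thesis by eventually_elim (use \<open>\<Omega> \<subseteq> \<Union>F\<close> F'(3) in blast)
qed

text \<open>
  Multiplying by a bump that is positive exactly on a ball inside the domain produces an integrable
  function on the whole space that is orthogonal to all test functions.
\<close>

lemma weak_gradient_unique:
  fixes u :: "real^'n \<Rightarrow> real^'m"
  assumes G: "has_weak_gradient \<Omega> u G" and H: "has_weak_gradient \<Omega> u H" and \<Omega>: "open \<Omega>"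
  shows "AE x in lebesgue_on \<Omega>. G x = H x"
proof -
  have \<Omega>m: "\<Omega> \<in> sets lebesgue" using \<Omega> by simp
  note GH = has_weak_gradient_diff[OF G H \<Omega>m]
  have L1: "L1_loc \<Omega> (\<lambda>x. G x - H x)" using GH by (simp add: has_weak_gradient_def)
  have "AE y in lebesgue. y \<in> ball x r \<longrightarrow> G y = H y" if r: "r > 0" and sub: "cball x r \<subseteq> \<Omega>" for x r
  proof -
    define \<psi> where "\<psi> y = bump r (y - x)" for y
    have g: "GDERIV \<psi> y :> grad (bump r) (y - x)" for y
    proof -
      have "(bump r has_derivative (\<lambda>h. h \<bullet> grad (bump r) (y - x))) (at (y - x))"
        using C1_on_gderiv[OF C1_bump] by (simp add: gderiv_def)
      from has_derivative_compose[of "\<lambda>y. y - x" "\<lambda>h. h" y UNIV, OF _ this]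
      show ?thesis unfolding gderiv_def \<psi>_def
        by (simp add: has_derivative_diff[of "\<lambda>y. y" "\<lambda>y. y" _ "\<lambda>_. x" "\<lambda>_. 0", simplified])
    qed
    have C1: "C1_on UNIV \<psi>"
      by (rule C1_onI_gderiv[OF g])
         (intro continuous_on_compose2[OF C1_on_continuous_grad[OF C1_bump]] continuous_intros, auto)
    have \<psi>0: "\<psi> y = 0" if "y \<notin> cball x r" for y
      unfolding \<psi>_def using that r by (intro bump_eq_0) (auto simp: dist_norm norm_minus_commute)
    have \<psi>: "test_fun \<Omega> \<psi>"
      by (rule test_funI[OF C1 compact_cball sub \<psi>0])
    have "AE y in lebesgue. \<psi> y * (G y - H y) $ j $ i = 0" for i j
    proof (rule AE_eq_0_if_orthogonal_to_test_funs)
      show "integrable lebesgue (\<lambda>y. \<psi> y * (G y - H y) $ j $ i)"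
        using weak_gradient_integrable(2)[OF \<psi> L1, of j i] by (simp add: mult.commute)
      fix \<phi> :: "real^'n \<Rightarrow> real" assume \<phi>: "test_fun UNIV \<phi>"
      have "C1_on UNIV \<phi>" using \<phi> by (simp add: test_fun_def)
      from GH test_fun_mult(1)[OF \<psi> this]
      have "(LINT x|lebesgue. (u x - u x) $ j * grad (\<lambda>x. \<phi> x * \<psi> x) x $ i)
          = - (LINT x|lebesgue. (G x - H x) $ j $ i * (\<phi> x * \<psi> x))"
        unfolding has_weak_gradient_iff[OF \<Omega>m] by blast
      then show "(LINT y|lebesgue. \<psi> y * (G y - H y) $ j $ i * \<phi> y) = 0"
        by (simp add: mult_ac)
    qed
    then have "AE y in lebesgue. \<forall>j i. \<psi> y * (G y - H y) $ j $ i = 0"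
      by (simp only: AE_all_countable) blast
    then show ?thesis
    proof eventually_elim
      case (elim y)
      show ?case
      proof
        assume "y \<in> ball x r"
        then have "\<psi> y > 0" using r by (simp add: \<psi>_def bump_pos_iff dist_norm norm_minus_commute)
        then show "G y = H y" using elim by (simp add: vec_eq_iff)
      qed
    qed
  qed
  from AE_local[OF \<Omega> this] show ?thesis
    using \<Omega>m by (simp add: AE_restrict_space_iff)
qed

text \<open>
  This removes the choice operator from every energy and norm: on an open set any weak gradient
  may stand for the chosen one.
\<close>

lemma weak_gradient_AE_eq:
  fixes u :: "real^'n \<Rightarrow> real^'m"
  assumes G: "has_weak_gradient \<Omega> u G" and \<Omega>: "open \<Omega>"
  shows "AE x in lebesgue_on \<Omega>. weak_gradient \<Omega> u x = G x"
  using weak_gradient_unique[OF _ G \<Omega>] someI[of "has_weak_gradient \<Omega> u", OF G]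
  by (simp add: weak_gradient_def)


section \<open>Products with cutoffs and the zero-trace space\<close>

text \<open>
  The matrix \<open>p q\<^sup>T\<close>, which the product rule for a scalar times a vector field produces.
\<close>

definition outer :: "real^'m \<Rightarrow> real^'n \<Rightarrow> real^'n^'m" where
  "outer p q = (\<chi> j. p $ j *\<^sub>R q)"

lemma norm_outer: "norm (outer p q) = norm p * norm q"
proof -
  have "(\<Sum>j\<in>UNIV. (norm (outer p q $ j))\<^sup>2) = (\<Sum>j\<in>UNIV. (norm (p $ j))\<^sup>2) * (norm q)\<^sup>2"
    by (simp add: outer_def power_mult_distrib sum_distrib_right)
  then show ?thesis
    unfolding norm_vec_def[of "outer p q"] norm_vec_def[of p] L2_set_def by (simp only: real_sqrt_mult) simp
qed

lemma bounded_bilinear_outer: "bounded_bilinear outer"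
proof
  show "\<exists>K. \<forall>p q. norm (outer p q) \<le> norm p * norm q * K"
    by (rule exI[of _ 1]) (simp add: norm_outer)
qed (auto simp: outer_def vec_eq_iff algebra_simps)

lemma borel_measurable_outer:
  assumes "p \<in> borel_measurable M" "q \<in> borel_measurable M"
  shows "(\<lambda>x. outer (p x) (q x)) \<in> borel_measurable M"
  by (rule borel_measurable_continuous_Pair[OF assms])
     (intro bounded_bilinear.continuous_on[OF bounded_bilinear_outer] continuous_intros)

lemma borel_measurable_L1_loc:
  fixes f :: "real^'n \<Rightarrow> 'b::euclidean_space"
  assumes "L1_loc UNIV f"
  shows "f \<in> borel_measurable lebesgue"
proof (rule borel_measurable_LIMSEQ_metric)
  show "(\<lambda>x. indicator (cball 0 (real k)) x *\<^sub>R f x) \<in> borel_measurable lebesgue" for k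
    using assms unfolding L1_loc_iff by (intro borel_measurable_integrable) auto
  show "(\<lambda>k. indicator (cball 0 (real k)) x *\<^sub>R f x) \<longlonglongrightarrow> f x" for x
  proof (rule tendsto_eventually)
    obtain N where "norm x \<le> real N" using real_arch_simple by blast
    then show "\<forall>\<^sub>F k in sequentially. indicator (cball 0 (real k)) x *\<^sub>R f x = f x"
      unfolding eventually_sequentially by (intro exI[of _ N]) (auto simp: indicator_def)
  qed
qed

text \<open>
  Lebesgue measure is complete, so measurability survives changes on null sets.  It is needed
  because nothing is known about the chosen weak gradient except that it agrees almost everywhere
  with a measurable function.
\<close>

lemma borel_measurable_lebesgue_on_AE_eq:
  fixes f g :: "'a::euclidean_space \<Rightarrow> 'b::euclidean_space"
  assumes g: "g \<in> borel_measurable lebesgue" and \<Omega>: "\<Omega> \<in> sets lebesgue"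
    and eq: "AE x in lebesgue_on \<Omega>. f x = g x"
  shows "f \<in> borel_measurable (lebesgue_on \<Omega>)"
proof -
  define h where "h x = (if x \<in> \<Omega> then f x else g x)" for x
  have "AE x in lebesgue. h x = g x"
    using eq \<Omega> by (simp add: AE_restrict_space_iff h_def)
  then obtain N where N: "N \<in> null_sets lebesgue" "{x. h x \<noteq> g x} \<subseteq> N"
    unfolding eventually_ae_filter by auto
  have "h measurable_on UNIV"
    by (rule measurable_on_spike[of g UNIV N])
       (use lebesgue_measurable_imp_measurable_on[OF g, of UNIV] N in \<open>auto simp: negligible_iff_null_sets\<close>)
  then have "h \<in> borel_measurable lebesgue"
    by (rule measurable_on_imp_borel_measurable_lebesgue_UNIV)
  then have "h \<in> borel_measurable (lebesgue_on \<Omega>)" by (rule measurable_restrict_space1)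
  then show ?thesis
    by (rule measurable_cong[THEN iffD1, rotated]) (simp add: h_def)
qed

lemma has_weak_gradient_const: "\<Omega> \<in> sets lebesgue \<Longrightarrow> has_weak_gradient \<Omega> (\<lambda>_. a) (\<lambda>_. 0)"
  by (rule has_weak_gradient_C1) (auto intro!: continuous_intros)

text \<open>
  The product of \<open>\<psi>\<close> with a test function is again a test function, so the product rule for
  gradients of smooth functions passes to the weak gradient.  The bounds are those that
  mollification of the product requires.
\<close>

lemma has_weak_gradient_scaleR:
  fixes u :: "real^'n \<Rightarrow> real^'m" and \<psi> :: "real^'n \<Rightarrow> real"
  assumes u: "has_weak_gradient UNIV u G"
    and uB: "AE x in lebesgue. norm (u x) \<le> B" and GB: "AE x in lebesgue. norm (G x) \<le> B"
    and \<psi>: "C1_on UNIV \<psi>" "\<And>x. \<bar>\<psi> x\<bar> \<le> b" "\<And>x. norm (grad \<psi> x) \<le> b"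
  shows "has_weak_gradient UNIV (\<lambda>x. \<psi> x *\<^sub>R u x) (\<lambda>x. \<psi> x *\<^sub>R G x + outer (u x) (grad \<psi> x))"
    and "(\<lambda>x. \<psi> x *\<^sub>R u x) \<in> borel_measurable lebesgue"
    and "(\<lambda>x. \<psi> x *\<^sub>R G x + outer (u x) (grad \<psi> x)) \<in> borel_measurable lebesgue"
    and "AE x in lebesgue. norm (\<psi> x *\<^sub>R u x) \<le> b * B"
    and "AE x in lebesgue. norm (\<psi> x *\<^sub>R G x + outer (u x) (grad \<psi> x)) \<le> 2 * b * B"
proof -
  have L1: "L1_loc UNIV u" "L1_loc UNIV G" using u by (simp_all add: has_weak_gradient_def)
  note um = borel_measurable_L1_loc[OF L1(1)] and Gm = borel_measurable_L1_loc[OF L1(2)]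
  have \<psi>m: "\<psi> \<in> borel_measurable lebesgue" "grad \<psi> \<in> borel_measurable lebesgue"
    using \<psi>(1) by (auto intro!: borel_measurable_lebesgue_continuous C1_on_continuous C1_on_continuous_grad)
  have b: "b \<ge> 0" using \<psi>(2)[of undefined] by linarith
  show m1: "(\<lambda>x. \<psi> x *\<^sub>R u x) \<in> borel_measurable lebesgue"
    and m2: "(\<lambda>x. \<psi> x *\<^sub>R G x + outer (u x) (grad \<psi> x)) \<in> borel_measurable lebesgue"
    by (intro borel_measurable_add borel_measurable_scaleR borel_measurable_outer um Gm \<psi>m)+
  show b1: "AE x in lebesgue. norm (\<psi> x *\<^sub>R u x) \<le> b * B"
    using uB by eventually_elim (use \<psi>(2) b in \<open>auto intro!: mult_mono\<close>)
  show b2: "AE x in lebesgue. norm (\<psi> x *\<^sub>R G x + outer (u x) (grad \<psi> x)) \<le> 2 * b * B"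
    using uB GB
  proof eventually_elim
    case (elim x)
    have "norm (\<psi> x *\<^sub>R G x) \<le> b * B"
      using \<psi>(2) b elim by (auto intro!: mult_mono)
    moreover have "norm (outer (u x) (grad \<psi> x)) \<le> B * b"
      unfolding norm_outer using \<psi>(3) elim order_trans[OF norm_ge_zero elim(1)] by (intro mult_mono) auto
    ultimately show ?case
      using norm_triangle_ineq[of "\<psi> x *\<^sub>R G x" "outer (u x) (grad \<psi> x)"] by (simp add: mult.commute)
  qed
  have L1o: "L1_loc UNIV (\<lambda>x. \<psi> x *\<^sub>R u x)" "L1_loc UNIV (\<lambda>x. \<psi> x *\<^sub>R G x + outer (u x) (grad \<psi> x))"
    using L1_loc_bounded[OF m1 b1] L1_loc_bounded[OF m2 b2] by blast+
  have U: "UNIV \<in> sets (lebesgue::(real^'n) measure)" by simp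
  show "has_weak_gradient UNIV (\<lambda>x. \<psi> x *\<^sub>R u x) (\<lambda>x. \<psi> x *\<^sub>R G x + outer (u x) (grad \<psi> x))"
    unfolding has_weak_gradient_iff[OF U]
  proof (intro conjI allI impI L1o)
    fix \<phi> :: "real^'n \<Rightarrow> real" and i j assume \<phi>: "test_fun UNIV \<phi>"
    let ?A = "\<lambda>x. (\<psi> x *\<^sub>R u x) $ j * grad \<phi> x $ i"
    let ?B = "\<lambda>x. (\<psi> x *\<^sub>R G x + outer (u x) (grad \<psi> x)) $ j $ i * \<phi> x"
    let ?C = "\<lambda>x. u x $ j * grad (\<lambda>x. \<psi> x * \<phi> x) x $ i"
    let ?D = "\<lambda>x. G x $ j $ i * (\<psi> x * \<phi> x)"
    note \<phi>\<psi> = test_fun_mult[OF \<phi> \<psi>(1)]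
    have int: "integrable lebesgue ?A" "integrable lebesgue ?B" "integrable lebesgue ?C" "integrable lebesgue ?D"
      by (rule weak_gradient_integrable[OF \<phi>] weak_gradient_integrable[OF \<phi>\<psi>(1)], (rule L1 L1o))+
    have "(LINT x|lebesgue. ?A x) + (LINT x|lebesgue. ?B x) = (LINT x|lebesgue. ?A x + ?B x)"
      by (rule Bochner_Integration.integral_add[OF int(1,2), symmetric])
    also have "\<dots> = (LINT x|lebesgue. ?C x + ?D x)"
      by (rule Bochner_Integration.integral_cong[OF refl], simp only: \<phi>\<psi>(2))
         (simp add: outer_def algebra_simps)
    also have "\<dots> = (LINT x|lebesgue. ?C x) + (LINT x|lebesgue. ?D x)"
      by (rule Bochner_Integration.integral_add[OF int(3,4)])
    also have "(LINT x|lebesgue. ?C x) = - (LINT x|lebesgue. ?D x)"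
      using u \<phi>\<psi>(1) unfolding has_weak_gradient_iff[OF U] by blast
    finally show "(LINT x|lebesgue. ?A x) = - (LINT x|lebesgue. ?B x)" by simp
  qed
qed

lemma L2_bounded:
  fixes f :: "real^'n \<Rightarrow> 'b::euclidean_space"
  assumes f: "f \<in> borel_measurable lebesgue" and B: "AE x in lebesgue. norm (f x) \<le> B"
    and \<Omega>: "\<Omega> \<in> lmeasurable"
  shows "L2 \<Omega> f"
  unfolding L2_def
proof
  have \<Omega>m: "\<Omega> \<in> sets lebesgue" using \<Omega> by (rule fmeasurableD)
  show m: "f \<in> borel_measurable (lebesgue_on \<Omega>)" using f by (rule measurable_restrict_space1)
  show "integrable (lebesgue_on \<Omega>) (\<lambda>x. (norm (f x))\<^sup>2)"
  proof (rule Bochner_Integration.integrable_bound[of _ "\<lambda>_. B\<^sup>2"])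
    show "integrable (lebesgue_on \<Omega>) (\<lambda>_. B\<^sup>2)"
      by (rule finite_measure.integrable_const[OF finite_measure_lebesgue_on[OF \<Omega>]])
    show "(\<lambda>x. (norm (f x))\<^sup>2) \<in> borel_measurable (lebesgue_on \<Omega>)" using m by measurable
    have "AE x in lebesgue_on \<Omega>. norm (f x) \<le> B"
    proof -
      have "AE x in lebesgue. x \<in> \<Omega> \<longrightarrow> norm (f x) \<le> B" using B by eventually_elim simp
      then show ?thesis using \<Omega>m by (simp add: AE_restrict_space_iff)
    qed
    then show "AE x in lebesgue_on \<Omega>. norm ((norm (f x))\<^sup>2) \<le> norm (B\<^sup>2)"
      by eventually_elim (simp add: power_mono)
  qed
qed

text \<open>
  Mollifications at scales smaller than the distance from the support to the boundary are test
  functions on the domain, and their gradients are the mollified weak gradients; both converge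
  in \<open>L\<^sup>2\<close>.
\<close>

lemma W12_0_compact_support:
  fixes v :: "real^'n \<Rightarrow> real^'m"
  assumes v: "has_weak_gradient UNIV v G"
    and vB: "AE x in lebesgue. norm (v x) \<le> B" and GB: "AE x in lebesgue. norm (G x) \<le> B"
    and supp: "\<And>x. x \<notin> cball 0 R \<Longrightarrow> v x = 0" and R: "R < R'"
    and \<Omega>: "open \<Omega>" "bounded \<Omega>" "cball 0 R' \<subseteq> \<Omega>"
  shows "W12_0 \<Omega> v"
proof -
  have L1: "L1_loc UNIV v" "L1_loc UNIV G" using v by (simp_all add: has_weak_gradient_def)
  note vm = borel_measurable_L1_loc[OF L1(1)] and Gm = borel_measurable_L1_loc[OF L1(2)]
  have \<Omega>l: "\<Omega> \<in> lmeasurable" using \<Omega> by (simp add: bounded_set_imp_lmeasurable)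
  have \<Omega>m: "\<Omega> \<in> sets lebesgue" using \<Omega> by simp
  define \<rho> :: "nat \<Rightarrow> real" where "\<rho> k = (R' - R) * inverse (real (Suc k))" for k
  have \<rho>: "\<rho> k > 0" "\<rho> k \<le> R' - R" for k
    using R unfolding \<rho>_def by (simp, intro mult_left_le) (auto simp: inverse_le_1_iff)
  have "(\<lambda>k. (R' - R) * inverse (real (Suc k))) \<longlonglongrightarrow> (R' - R) * 0"
    by (intro tendsto_intros LIMSEQ_inverse_real_of_nat)
  then have \<rho>0: "\<rho> \<longlonglongrightarrow> 0" by (simp add: \<rho>_def[abs_def])
  define \<phi> where "\<phi> k = conv (mollifier (\<rho> k)) v" for k
  define H where "H k = conv (mollifier (\<rho> k)) G" for k
  have K: "compact (cball (0::real^'n) (\<rho> k))" "C1_on UNIV (mollifier (\<rho> k) :: real^'n \<Rightarrow> real)"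
    "\<And>x::real^'n. x \<notin> cball 0 (\<rho> k) \<Longrightarrow> mollifier (\<rho> k) x = 0" for k
    by (auto intro: C1_mollifier mollifier_eq_0 \<rho>(1))
  have test: "test_fun \<Omega> (\<phi> k)" for k
  proof (rule test_funI)
    show "C1_on UNIV (\<phi> k)" unfolding \<phi>_def by (rule C1_on_conv[OF L1(1) K])
    show "\<phi> k x = 0" if "x \<notin> cball 0 R'" for x
    proof -
      have "norm x > R + \<rho> k" using that \<rho>(2)[of k] by simp
      then show ?thesis unfolding \<phi>_def by (rule conv_mollifier_eq_0[OF \<rho>(1) supp, rotated])
    qed
  qed (use \<Omega> in auto)
  have wk: "AE x in lebesgue_on \<Omega>. weak_gradient \<Omega> (\<lambda>x. v x - \<phi> k x) x = G x - H k x" for k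
  proof (rule weak_gradient_AE_eq[OF has_weak_gradient_diff[OF has_weak_gradient_subset[OF v \<Omega>m] _ \<Omega>m] \<Omega>(1)])
    show "has_weak_gradient \<Omega> (\<phi> k) (H k)"
      unfolding \<phi>_def H_def
      by (rule has_weak_gradient_C1[OF has_derivative_conv_weak_gradient[OF v K]
            continuous_on_conv[OF L1(2) K(1) C1_on_continuous[OF K(2)] K(3)] \<Omega>m])
  qed
  obtain r where "\<Omega> \<subseteq> cball 0 r"
    using bounded_subset_ballD[OF \<Omega>(2), of 0] ball_subset_cball by blast
  note conv = conv_tendsto_L2[OF vm vB \<rho>(1) \<rho>0 \<Omega>m this] conv_tendsto_L2[OF Gm GB \<rho>(1) \<rho>0 \<Omega>m this]
  have Hm: "H k \<in> borel_measurable lebesgue" for k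
    unfolding H_def
    by (intro borel_measurable_lebesgue_continuous continuous_on_conv[OF L1(2) K(1) C1_on_continuous[OF K(2)] K(3)])
  have norm_eq: "W12_norm \<Omega> (\<lambda>x. v x - \<phi> k x) = sqrt ((LINT x|lebesgue_on \<Omega>. (norm (v x - \<phi> k x))\<^sup>2) +
      (LINT x|lebesgue_on \<Omega>. (norm (G x - H k x))\<^sup>2))" for k
  proof -
    have "(LINT x|lebesgue_on \<Omega>. (norm (weak_gradient \<Omega> (\<lambda>x. v x - \<phi> k x) x))\<^sup>2)
      = (LINT x|lebesgue_on \<Omega>. (norm (G x - H k x))\<^sup>2)"
    proof -
      have D: "(\<lambda>x. G x - H k x) \<in> borel_measurable lebesgue"
        using Gm Hm by measurable
      show ?thesis
      proof (rule integral_cong_AE)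
        show "AE x in lebesgue_on \<Omega>. (norm (weak_gradient \<Omega> (\<lambda>x. v x - \<phi> k x) x))\<^sup>2 = (norm (G x - H k x))\<^sup>2"
          using wk[of k] by eventually_elim simp
        show "(\<lambda>x. (norm (weak_gradient \<Omega> (\<lambda>x. v x - \<phi> k x) x))\<^sup>2) \<in> borel_measurable (lebesgue_on \<Omega>)"
          using borel_measurable_lebesgue_on_AE_eq[OF D \<Omega>m wk[of k]] by measurable
        show "(\<lambda>x. (norm (G x - H k x))\<^sup>2) \<in> borel_measurable (lebesgue_on \<Omega>)"
          using measurable_restrict_space1[OF D, of \<Omega>] by measurable
      qed
    qed
    then show ?thesis by (simp add: W12_norm_def)
  qed
  from tendsto_real_sqrt[OF tendsto_add[OF conv]]
  have "(\<lambda>k. W12_norm \<Omega> (\<lambda>x. v x - \<phi> k x)) \<longlonglongrightarrow> sqrt (0 + 0)"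
    unfolding norm_eq \<phi>_def[symmetric] H_def[symmetric] .
  moreover have "W12 \<Omega> v"
    unfolding W12_def
    using has_weak_gradient_subset[OF v \<Omega>m] L2_bounded[OF vm vB \<Omega>l] L2_bounded[OF Gm GB \<Omega>l] by blast
  ultimately show ?thesis
    unfolding W12_0_def using test by (intro conjI exI[of _ \<phi>]) simp_all
qed


section \<open>The potential near its zero\<close>

text \<open>
  Only the point \<open>a\<close> needs an argument, and there the regularity class gives continuity for each range of the
  exponent.
\<close>

lemma HA_continuous:
  fixes W :: "real^'m \<Rightarrow> real"
  assumes "HA W a"
  shows "continuous_on UNIV W"
proof -
  obtain \<alpha> where \<alpha>: "0 < \<alpha>" "\<alpha> \<le> 2" and Ca: "C_alpha \<alpha> W" and C1: "C1_on (- {a}) W"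
    using assms unfolding HA_def by blast
  have "isCont W a"
  proof -
    consider "\<alpha> < 1" | "\<alpha> = 1" | "\<alpha> > 1" by linarith
    then show ?thesis
    proof cases
      case 1
      then obtain r L where r: "r > 0" and L: "\<And>y z. y \<in> ball a r \<Longrightarrow> z \<in> ball a r \<Longrightarrow> norm (W y - W z) \<le> L * norm (y - z) powr \<alpha>"
        using Ca unfolding C_alpha_def locally_hoelder_def by meson
      have "((\<lambda>y. W y - W a) \<longlongrightarrow> 0) (at a)"
      proof (rule Lim_null_comparison)
        show "\<forall>\<^sub>F y in at a. norm (W y - W a) \<le> L * norm (y - a) powr \<alpha>"
          using L[of _ a] r unfolding eventually_at by (intro exI[of _ r]) (auto simp: dist_commute)
        have "((\<lambda>y. norm (y - a)) \<longlongrightarrow> 0) (at a)"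
          by (auto intro!: tendsto_eq_intros)
        then have "((\<lambda>y. norm (y - a) powr \<alpha>) \<longlongrightarrow> 0) (at a)"
          using \<alpha> by (intro tendsto_zero_powrI[of _ _ _ \<alpha>]) auto
        then show "((\<lambda>y. L * norm (y - a) powr \<alpha>) \<longlongrightarrow> 0) (at a)"
          by (rule tendsto_mult_right_zero)
      qed
      then show ?thesis by (simp add: isCont_def LIM_zero_iff)
    next
      case 2
      then obtain r L where "r > 0" "L-lipschitz_on (ball a r) W"
        using Ca unfolding C_alpha_def by blast
      then have "continuous_on (ball a r) W" by (rule_tac lipschitz_on_continuous_on)
      then show ?thesis using \<open>r > 0\<close> by (simp add: continuous_on_eq_continuous_at)
    next
      case 3
      then have "C1_on UNIV W" using Ca \<alpha> unfolding C_alpha_def by (cases "\<alpha> = 2") auto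
      then have "continuous_on UNIV W" by (rule C1_on_continuous)
      then show ?thesis by (simp add: continuous_on_eq_continuous_at)
    qed
  qed
  moreover have "isCont W x" if "x \<noteq> a" for x
    using C1_on_gderiv[OF C1, of x] that unfolding gderiv_def by (auto intro: has_derivative_continuous)
  ultimately show ?thesis
    by (metis continuous_at_imp_continuous_on)
qed

text \<open>
  All exponents lead to the same linear lower bound.  For \<open>\<alpha> < 2\<close> it follows since
  \<open>\<rho> powr (\<alpha> - 2)\<close> is decreasing in \<open>\<rho>\<close>; for \<open>\<alpha> = 2\<close> the gradient vanishes at the minimum \<open>a\<close>, and the Hessian
  is its linear part there, with an error small uniformly in the direction.
\<close>

lemma HA_radial_derivative:
  fixes W :: "real^'m \<Rightarrow> real"
  assumes HA: "HA W a"
  obtains c r where "c > 0" "r > 0"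
    "\<And>\<rho> \<nu>. 0 < \<rho> \<Longrightarrow> \<rho> \<le> r \<Longrightarrow> norm \<nu> = 1 \<Longrightarrow> grad W (a + \<rho> *\<^sub>R \<nu>) \<bullet> \<nu> \<ge> c * \<rho>"
proof -
  obtain \<alpha> where \<alpha>: "0 < \<alpha>" "\<alpha> \<le> 2" and Ca: "C_alpha \<alpha> W"
    and lt: "\<alpha> < 2 \<Longrightarrow> \<exists>C>0. \<exists>\<rho>\<^sub>0>0. \<forall>\<rho> \<nu>. 0 < \<rho> \<and> \<rho> \<le> \<rho>\<^sub>0 \<and> norm \<nu> = 1 \<longrightarrow>
                     grad W (a + \<rho> *\<^sub>R \<nu>) \<bullet> \<nu> \<ge> C * \<rho> powr (\<alpha> - 1)"
    and eq: "\<alpha> = 2 \<Longrightarrow> \<exists>C\<^sub>0>0. \<forall>\<nu>. norm \<nu> = 1 \<longrightarrow> (hessian W a *v \<nu>) \<bullet> \<nu> \<ge> C\<^sub>0"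
    using HA unfolding HA_def by blast
  show ?thesis
  proof (cases "\<alpha> < 2")
    case True
    then obtain C r where C: "C > 0" "r > 0" "\<And>\<rho> \<nu>. 0 < \<rho> \<Longrightarrow> \<rho> \<le> r \<Longrightarrow> norm \<nu> = 1 \<Longrightarrow>
        grad W (a + \<rho> *\<^sub>R \<nu>) \<bullet> \<nu> \<ge> C * \<rho> powr (\<alpha> - 1)"
      using lt by meson
    show ?thesis
    proof (rule that[of "C * r powr (\<alpha> - 2)" r])
      fix \<rho> and \<nu> :: "real^'m" assume \<rho>: "0 < \<rho>" "\<rho> \<le> r" and \<nu>: "norm \<nu> = 1"
      have "C * r powr (\<alpha> - 2) * \<rho> \<le> C * \<rho> powr (\<alpha> - 2) * \<rho>"
        using \<rho> C True by (intro mult_right_mono mult_left_mono powr_mono2') auto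
      also have "\<dots> = C * \<rho> powr (\<alpha> - 1)"
        using \<rho> powr_add[of \<rho> "\<alpha> - 2" 1] by simp
      finally show "grad W (a + \<rho> *\<^sub>R \<nu>) \<bullet> \<nu> \<ge> C * r powr (\<alpha> - 2) * \<rho>"
        using C(3)[OF \<rho> \<nu>] by linarith
    qed (use C in auto)
  next
    case False
    then have 2: "\<alpha> = 2" using \<alpha> by simp
    then obtain C where C: "C > 0" "\<And>\<nu>. norm \<nu> = 1 \<Longrightarrow> (hessian W a *v \<nu>) \<bullet> \<nu> \<ge> C"
      using eq by blast
    have C1: "C1_on UNIV W" "C1_on UNIV (grad W)" using Ca 2 unfolding C_alpha_def by auto
    have "(\<lambda>h. h \<bullet> grad W a) = (\<lambda>h. 0)"
      using HA C1_on_gderiv[OF C1(1), of a]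
      by (intro has_derivative_local_min[of W _ a]) (auto simp: HA_def gderiv_def intro: always_eventually)
    from fun_cong[OF this, of "grad W a"] have g0: "grad W a = 0" by simp
    have "grad W differentiable (at a)"
      using C1(2) unfolding C1_on_def differentiable_def by auto
    then have "(grad W has_derivative (\<lambda>h. hessian W a *v h)) (at a)"
      unfolding hessian_def by (simp add: jacobian_works)
    moreover have "C / 2 > 0" using C by simp
    ultimately obtain d where d: "d > 0" "\<And>y. norm (y - a) < d \<Longrightarrow>
        norm (grad W y - grad W a - hessian W a *v (y - a)) \<le> C / 2 * norm (y - a)"
      unfolding has_derivative_at_alt by metis
    show ?thesis
    proof (rule that[of "C / 2" "d / 2"])
      fix \<rho> and \<nu> :: "real^'m" assume \<rho>: "0 < \<rho>" "\<rho> \<le> d / 2" and \<nu>: "norm \<nu> = 1"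
      let ?E = "grad W (a + \<rho> *\<^sub>R \<nu>) - hessian W a *v (\<rho> *\<^sub>R \<nu>)"
      have "norm ?E \<le> C / 2 * \<rho>"
        using d(2)[of "a + \<rho> *\<^sub>R \<nu>"] \<rho> \<nu> g0 d(1) by simp
      moreover have "\<bar>?E \<bullet> \<nu>\<bar> \<le> norm ?E" using Cauchy_Schwarz_ineq2[of ?E \<nu>] \<nu> by simp
      moreover have "(hessian W a *v (\<rho> *\<^sub>R \<nu>)) \<bullet> \<nu> \<ge> \<rho> * C"
        using C(2)[OF \<nu>] \<rho> by (simp add: matrix_vector_mult_scaleR)
      ultimately show "grad W (a + \<rho> *\<^sub>R \<nu>) \<bullet> \<nu> \<ge> C / 2 * \<rho>"
        by (simp add: inner_diff_left algebra_simps)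
    qed (use C d in auto)
  qed
qed

text \<open>
  The derivative bound says that \<open>W\<close> minus a quadratic increases along short rays from \<open>a\<close>.  Taking \<open>s = 0\<close>
  gives quadratic growth, and dropping the quadratic term gives monotonicity.
\<close>

lemma HA_radial_growth:
  fixes W :: "real^'m \<Rightarrow> real"
  assumes HA: "HA W a"
  obtains c r where "c > 0" "r > 0"
    "\<And>s t \<nu>. 0 \<le> s \<Longrightarrow> s \<le> t \<Longrightarrow> t \<le> r \<Longrightarrow> norm \<nu> = 1 \<Longrightarrow>
       W (a + s *\<^sub>R \<nu>) + c * (t\<^sup>2 - s\<^sup>2) \<le> W (a + t *\<^sub>R \<nu>)"
proof -
  obtain c r where c: "c > 0" "r > 0"
    "\<And>\<rho> \<nu>. 0 < \<rho> \<Longrightarrow> \<rho> \<le> r \<Longrightarrow> norm \<nu> = 1 \<Longrightarrow> grad W (a + \<rho> *\<^sub>R \<nu>) \<bullet> \<nu> \<ge> c * \<rho>"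
    using HA_radial_derivative[OF HA] by blast
  have C1: "C1_on (- {a}) W" using HA unfolding HA_def by blast
  show ?thesis
  proof (rule that[of "c / 2" r])
    fix s t and \<nu> :: "real^'m" assume st: "0 \<le> s" "s \<le> t" "t \<le> r" and \<nu>: "norm \<nu> = 1"
    let ?f = "\<lambda>t. W (a + t *\<^sub>R \<nu>) - c / 2 * t\<^sup>2"
    have "?f s \<le> ?f t"
    proof (rule DERIV_nonneg_imp_increasing_open[OF st(2)])
      fix x assume x: "s < x" "x < t"
      have "a + x *\<^sub>R \<nu> \<noteq> a" using x st \<nu> by auto
      then have "(W has_derivative (\<lambda>h. h \<bullet> grad W (a + x *\<^sub>R \<nu>))) (at (a + x *\<^sub>R \<nu>))"
        using C1_on_gderiv[OF C1] by (simp add: gderiv_def)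
      moreover have "((\<lambda>x. a + x *\<^sub>R \<nu>) has_derivative (\<lambda>h. h *\<^sub>R \<nu>)) (at x)"
        by (auto intro!: derivative_eq_intros)
      ultimately have "((\<lambda>x. W (a + x *\<^sub>R \<nu>)) has_derivative (\<lambda>h. (h *\<^sub>R \<nu>) \<bullet> grad W (a + x *\<^sub>R \<nu>))) (at x)"
        by (rule has_derivative_compose[rotated])
      then have "((\<lambda>x. W (a + x *\<^sub>R \<nu>)) has_real_derivative (grad W (a + x *\<^sub>R \<nu>) \<bullet> \<nu>)) (at x)"
        by (simp add: has_field_derivative_def inner_commute mult_commute_abs)
      then have "(?f has_real_derivative (grad W (a + x *\<^sub>R \<nu>) \<bullet> \<nu> - c * x)) (at x)"
        by (auto intro!: derivative_eq_intros)
      moreover have "grad W (a + x *\<^sub>R \<nu>) \<bullet> \<nu> - c * x \<ge> 0"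
        using c(3)[of x \<nu>] x st \<nu> by auto
      ultimately show "\<exists>y. (?f has_real_derivative y) (at x) \<and> 0 \<le> y" by blast
    next
      show "continuous_on {s..t} ?f"
        by (intro continuous_intros continuous_on_compose2[OF HA_continuous[OF HA]]) auto
    qed
    then show "W (a + s *\<^sub>R \<nu>) + c / 2 * (t\<^sup>2 - s\<^sup>2) \<le> W (a + t *\<^sub>R \<nu>)"
      by (simp add: algebra_simps)
  qed (use c in auto)
qed

text \<open>
  The two facts about \<open>W\<close> on which the comparison rests: on \<open>K\<close> the potential controls the
  squared distance to \<open>a\<close>, and shrinking towards \<open>a\<close> costs at most a constant factor.  Near \<open>a\<close> both come
  from radial growth; away from \<open>a\<close> the potential has a positive minimum on the compact set \<open>K\<close>, so it
  dominates any bounded quantity.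
\<close>

lemma potential_controls:
  fixes W :: "real^'m \<Rightarrow> real"
  assumes HA: "HA W a" and K: "compact K" and zero: "\<And>z. z \<in> K \<Longrightarrow> W z = 0 \<Longrightarrow> z = a"
  obtains C where "C > 0" "\<And>z. z \<in> K \<Longrightarrow> (norm (z - a))\<^sup>2 \<le> C * W z"
    "\<And>z t. z \<in> K \<Longrightarrow> 0 \<le> t \<Longrightarrow> t \<le> 1 \<Longrightarrow> W (a + t *\<^sub>R (z - a)) \<le> C * W z"
proof -
  note cont = HA_continuous[OF HA]
  have W0: "W z \<ge> 0" "W a = 0" for z using HA by (auto simp: HA_def)
  obtain c r where c: "c > 0" "r > 0"
    "\<And>s t \<nu>. 0 \<le> s \<Longrightarrow> s \<le> t \<Longrightarrow> t \<le> r \<Longrightarrow> norm \<nu> = 1 \<Longrightarrow>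
       W (a + s *\<^sub>R \<nu>) + c * (t\<^sup>2 - s\<^sup>2) \<le> W (a + t *\<^sub>R \<nu>)"
    using HA_radial_growth[OF HA] by blast
  have "bounded ((\<lambda>z. z - a) ` K)"
    by (intro compact_imp_bounded compact_continuous_image K continuous_intros)
  then obtain M where M: "\<And>z. z \<in> K \<Longrightarrow> norm (z - a) \<le> M" by (auto simp: bounded_iff)
  have "bounded (W ` cball a M)"
    by (intro compact_imp_bounded compact_continuous_image) (auto intro: continuous_on_subset[OF cont])
  then obtain B where "\<forall>y\<in>W ` cball a M. norm y \<le> B" unfolding bounded_iff by blast
  from bspec[OF this imageI] have B: "W z \<le> B" if "z \<in> cball a M" for z
    using that abs_ge_self[of "W z"] by (metis order_trans real_norm_def)
  obtain w where w: "w > 0" "\<And>z. z \<in> K \<Longrightarrow> norm (z - a) \<ge> r \<Longrightarrow> W z \<ge> w"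
  proof (cases "K - ball a r = {}")
    case True
    then show ?thesis by (intro that[of 1]) (auto simp: dist_norm norm_minus_commute)
  next
    case False
    have "compact (K - ball a r)" using K by (simp add: compact_diff)
    then obtain z0 where z0: "z0 \<in> K - ball a r" "\<And>z. z \<in> K - ball a r \<Longrightarrow> W z0 \<le> W z"
      using continuous_attains_inf[OF _ False, of W] continuous_on_subset[OF cont] by blast
    have "z0 \<noteq> a" using z0 c by auto
    then have "W z0 > 0" using zero[of z0] z0 W0(1)[of z0] by (auto simp: less_le)
    then show ?thesis using z0(2) by (intro that[of "W z0"]) (auto simp: dist_norm norm_minus_commute)
  qed
  \<comment> \<open>The summands serve, in this order: shrinking near \<open>a\<close>, the distance near \<open>a\<close>, and both bounds away from \<open>a\<close>.\<close>
  define C where "C = 1 + 1 / c + (M\<^sup>2 + \<bar>B\<bar>) / w"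
  have near: "(norm (z - a))\<^sup>2 \<le> 1 / c * W z \<and> W (a + t *\<^sub>R (z - a)) \<le> 1 * W z"
    if z: "norm (z - a) < r" "0 \<le> t" "t \<le> 1" for z t
  proof (cases "z = a")
    case False
    define \<nu> where "\<nu> = (1 / norm (z - a)) *\<^sub>R (z - a)"
    have \<nu>: "norm \<nu> = 1" "norm (z - a) *\<^sub>R \<nu> = z - a" using False by (auto simp: \<nu>_def)
    have "W (a + 0 *\<^sub>R \<nu>) + c * ((norm (z - a))\<^sup>2 - 0\<^sup>2) \<le> W (a + norm (z - a) *\<^sub>R \<nu>)"
      by (rule c(3)) (use z \<nu> in auto)
    moreover have "W (a + (t * norm (z - a)) *\<^sub>R \<nu>) + c * ((norm (z - a))\<^sup>2 - (t * norm (z - a))\<^sup>2) \<le> W (a + norm (z - a) *\<^sub>R \<nu>)"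
      by (rule c(3)) (use z \<nu> in \<open>auto simp: mult_left_le_one_le\<close>)
    moreover have "c * ((norm (z - a))\<^sup>2 - (t * norm (z - a))\<^sup>2) \<ge> 0"
      using z c by (intro mult_nonneg_nonneg) (auto simp: mult_left_le_one_le power_mono)
    moreover have "(t * norm (z - a)) *\<^sub>R \<nu> = t *\<^sub>R (z - a)" using \<nu>(2) by (simp flip: scaleR_scaleR)
    ultimately have "c * (norm (z - a))\<^sup>2 \<le> W z" "W (a + t *\<^sub>R (z - a)) \<le> W z"
      using W0 \<nu>(2) by simp_all
    then show ?thesis using c by (simp add: field_simps)
  qed (simp add: W0)
  have far: "(norm (z - a))\<^sup>2 \<le> M\<^sup>2 / w * W z \<and> W (a + t *\<^sub>R (z - a)) \<le> \<bar>B\<bar> / w * W z"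
    if z: "z \<in> K" "norm (z - a) \<ge> r" "0 \<le> t" "t \<le> 1" for z t
  proof
    have "M\<^sup>2 / w * w \<le> M\<^sup>2 / w * W z" "\<bar>B\<bar> / w * w \<le> \<bar>B\<bar> / w * W z"
      using w z by (intro mult_left_mono; simp)+
    then have le: "M\<^sup>2 \<le> M\<^sup>2 / w * W z" "\<bar>B\<bar> \<le> \<bar>B\<bar> / w * W z" using w by auto
    have "(norm (z - a))\<^sup>2 \<le> M\<^sup>2" using M[OF z(1)] by (intro power_mono) auto
    then show "(norm (z - a))\<^sup>2 \<le> M\<^sup>2 / w * W z" using le by linarith
    have "norm (t *\<^sub>R (z - a)) \<le> M"
      using M[OF z(1)] z mult_left_le_one_le[of "norm (z - a)" t] by auto
    then have "W (a + t *\<^sub>R (z - a)) \<le> B" by (intro B) (simp add: dist_norm)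
    then show "W (a + t *\<^sub>R (z - a)) \<le> \<bar>B\<bar> / w * W z" using le by linarith
  qed
  have mono: "x * W z \<le> C * W z" if "x \<le> C" for x z
    using that W0(1) by (rule mult_right_mono)
  have C: "1 \<le> C" "1 / c \<le> C" "M\<^sup>2 / w \<le> C" "\<bar>B\<bar> / w \<le> C"
    using c w by (simp_all add: C_def add_divide_distrib)
  show ?thesis
  proof (rule that[of C])
    show "C > 0" using C by linarith
    show "(norm (z - a))\<^sup>2 \<le> C * W z" if "z \<in> K" for z
      using near[of z 0] far[OF that, of 0] mono[OF C(2), of z] mono[OF C(3), of z] by (cases "norm (z - a) < r") force+
    show "W (a + t *\<^sub>R (z - a)) \<le> C * W z" if "z \<in> K" "0 \<le> t" "t \<le> 1" for z t
      using near[of z t] far[OF that(1), of t] that mono[OF C(1), of z] mono[OF C(4), of z]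
      by (cases "norm (z - a) < r") force+
  qed
qed


section \<open>Growth of the energy\<close>

lemma energy_eq:
  fixes u :: "real^'n \<Rightarrow> real^'m"
  assumes G: "has_weak_gradient \<Omega> u G" and \<Omega>: "open \<Omega>"
  shows "energy W \<Omega> u = (\<integral>\<^sup>+x. ennreal (1/2 * (norm (G x))\<^sup>2 + W (u x)) * indicator \<Omega> x \<partial>lebesgue)"
proof -
  have "energy W \<Omega> u = (\<integral>\<^sup>+x. ennreal (1/2 * (norm (G x))\<^sup>2 + W (u x)) \<partial>lebesgue_on \<Omega>)"
    unfolding energy_def
    by (rule nn_integral_cong_AE, rule AE_mp[OF weak_gradient_AE_eq[OF assms]], rule AE_I2) simp
  then show ?thesis using \<Omega> by (simp add: nn_integral_restrict_space)
qed

text \<open>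
  The competitor \<open>a + (1 - \<psi>) (u - a)\<close> has no energy in the inner ball, where it equals \<open>a\<close>.  In the shell its
  gradient is at most \<open>\<bar>\<nabla>u\<bar> + 8 \<bar>u - a\<bar>\<close>, and the second term and the potential of the competitor are both controlled by
  \<open>W (u)\<close>.  The energy of \<open>u\<close> in the ball is therefore bounded by its energy in the shell alone.
\<close>

lemma minimal_hole_filling:
  fixes u :: "real^'n \<Rightarrow> real^'m"
  assumes min: "minimal_map W UNIV u" and G: "has_weak_gradient UNIV u G"
    and uM: "AE x in lebesgue. norm (u x - a) \<le> M" and GM: "AE x in lebesgue. norm (G x) \<le> M"
    and W: "\<And>z. 0 \<le> W z" "W a = 0" and C: "C > 0"
    and quad: "AE x in lebesgue. (norm (u x - a))\<^sup>2 \<le> C * W (u x)"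
    and seg: "AE x in lebesgue. \<forall>t. 0 \<le> t \<and> t \<le> 1 \<longrightarrow> W (a + t *\<^sub>R (u x - a)) \<le> C * W (u x)"
    and R: "R \<ge> 1"
  defines "e \<equiv> \<lambda>x. ennreal (1/2 * (norm (G x))\<^sup>2 + W (u x))"
  shows "(\<integral>\<^sup>+x. e x * indicator (ball 0 (R + 1)) x \<partial>lebesgue)
     \<le> (\<integral>\<^sup>+x. ennreal (2 + 65 * C) * (e x * indicator (ball 0 (R + 1) - ball 0 (R - 1)) x) \<partial>lebesgue)"
proof -
  define \<psi> where "\<psi> = (cutoff R :: real^'n \<Rightarrow> real)"
  define \<Omega> where "\<Omega> = ball (0::real^'n) (R + 1)"
  have \<Omega>: "open \<Omega>" "bounded \<Omega>" "\<Omega> \<in> sets lebesgue" by (simp_all add: \<Omega>_def)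
  define v where "v x = \<psi> x *\<^sub>R (a - u x)" for x
  define H where "H x = \<psi> x *\<^sub>R (0 - G x) + outer (a - u x) (grad \<psi> x)" for x
  have M0: "M \<ge> 0" by (rule AE_bound_nonneg[OF uM])
  have \<psi>: "C1_on UNIV \<psi>" "\<bar>\<psi> x\<bar> \<le> 8" "norm (grad \<psi> x) \<le> 8" "0 \<le> \<psi> x" "\<psi> x \<le> 1" for x
    using cutoff_C1_grad[OF R] cutoff_bounds[of R x] by (auto simp: \<psi>_def)
  have U: "UNIV \<in> sets (lebesgue::(real^'n) measure)" by simp
  have wau: "has_weak_gradient UNIV (\<lambda>x. a - u x) (\<lambda>x. 0 - G x)"
    by (rule has_weak_gradient_diff[OF has_weak_gradient_const[OF U] G U])
  have bau: "AE x in lebesgue. norm (a - u x) \<le> M" "AE x in lebesgue. norm (0 - G x) \<le> M"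
    using uM GM by (simp_all add: norm_minus_commute)
  note prod = has_weak_gradient_scaleR[OF wau bau \<psi>(1,2,3)]
  have v: "has_weak_gradient UNIV v H" unfolding v_def H_def by (rule prod(1))
  have vB: "AE x in lebesgue. norm (v x) \<le> 2 * 8 * M"
    using prod(4) unfolding v_def by (rule eventually_mono) (use M0 in auto)
  have HB: "AE x in lebesgue. norm (H x) \<le> 2 * 8 * M"
    using prod(5) unfolding H_def .
  have "W12_0 \<Omega> v"
  proof (rule W12_0_compact_support[OF v vB HB])
    show "v x = 0" if "x \<notin> cball 0 R" for x
      using that R by (simp add: v_def \<psi>_def cutoff_eq_0)
    show "R < R + 1/2" by simp
    show "cball 0 (R + 1/2) \<subseteq> \<Omega>" by (auto simp: \<Omega>_def)
  qed (use \<Omega> in auto)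
  then have "energy W \<Omega> u \<le> energy W \<Omega> (\<lambda>x. u x + v x)"
    using min \<Omega> unfolding minimal_map_def by blast
  also have "energy W \<Omega> (\<lambda>x. u x + v x) =
     (\<integral>\<^sup>+x. ennreal (1/2 * (norm (G x + H x))\<^sup>2 + W (u x + v x)) * indicator \<Omega> x \<partial>lebesgue)"
    by (rule energy_eq[OF has_weak_gradient_subset[OF has_weak_gradient_add[OF G v U] \<Omega>(3)] \<Omega>(1)])
  also have "\<dots> \<le> (\<integral>\<^sup>+x. ennreal (2 + 65 * C) * (e x * indicator (\<Omega> - ball 0 (R - 1)) x) \<partial>lebesgue)"
  proof (rule nn_integral_mono_AE)
    show "AE x in lebesgue. ennreal (1/2 * (norm (G x + H x))\<^sup>2 + W (u x + v x)) * indicator \<Omega> x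
        \<le> ennreal (2 + 65 * C) * (e x * indicator (\<Omega> - ball 0 (R - 1)) x)"
      using quad seg
    proof eventually_elim
      case (elim x)
      show ?case
      proof (cases "x \<in> \<Omega> - ball 0 (R - 1)")
        case True
        have "W (u x + v x) = W (a + (1 - \<psi> x) *\<^sub>R (u x - a))"
          by (simp add: v_def algebra_simps)
        also have "\<dots> \<le> C * W (u x)" using elim(2) \<psi>(4,5)[of x] by auto
        finally have 1: "W (u x + v x) \<le> C * W (u x)" .
        have "G x + H x = (1 - \<psi> x) *\<^sub>R G x + outer (a - u x) (grad \<psi> x)"
          by (simp add: H_def algebra_simps)
        then have "norm (G x + H x) \<le> norm ((1 - \<psi> x) *\<^sub>R G x) + norm (outer (a - u x) (grad \<psi> x))"
          by (simp only: norm_triangle_ineq)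
        also have "\<dots> \<le> norm (G x) + norm (u x - a) * 8"
          using \<psi>(3,4,5)[of x] unfolding norm_outer norm_minus_commute[of a]
          by (intro add_mono mult_left_mono) (auto intro!: mult_left_le_one_le)
        finally have "(norm (G x + H x))\<^sup>2 \<le> (norm (G x) + norm (u x - a) * 8)\<^sup>2"
          by (intro power_mono) auto
        also have "\<dots> \<le> 2 * (norm (G x))\<^sup>2 + 128 * (norm (u x - a))\<^sup>2"
          using sum_squares_ge_zero[of "norm (G x) - norm (u x - a) * 8" 0]
          by (simp add: power2_eq_square algebra_simps)
        also have "\<dots> \<le> 2 * (norm (G x))\<^sup>2 + 128 * (C * W (u x))" using elim(1) by simp
        finally have 2: "(norm (G x + H x))\<^sup>2 \<le> 2 * (norm (G x))\<^sup>2 + 128 * (C * W (u x))" .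
        have "0 \<le> 65 * C * (norm (G x))\<^sup>2" using C by simp
        then have "1/2 * (norm (G x + H x))\<^sup>2 + W (u x + v x) \<le> (2 + 65 * C) * (1/2 * (norm (G x))\<^sup>2 + W (u x))"
          using 1 2 W(1)[of "u x"] by (simp add: algebra_simps)
        then have "ennreal (1/2 * (norm (G x + H x))\<^sup>2 + W (u x + v x)) \<le> ennreal (2 + 65 * C) * e x"
          unfolding e_def using C W(1)[of "u x"] by (subst ennreal_mult[symmetric]) (auto intro: ennreal_leI)
        then show ?thesis using True by simp
      next
        case False
        show ?thesis
        proof (cases "x \<in> \<Omega>")
          case True
          then have x: "norm x < R - 1" using False by simp
          have "\<psi> x = 1" "grad \<psi> x = 0"
            using x cutoff_eq_1[of x R] grad_cutoff_eq_0[of x R] by (auto simp: \<psi>_def)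
          then have "G x + H x = 0" "u x + v x = a"
            by (simp_all add: H_def v_def outer_def vec_eq_iff)
          then show ?thesis using W by simp
        qed simp
      qed
    qed
  qed
  finally have "energy W \<Omega> u \<le> (\<integral>\<^sup>+x. ennreal (2 + 65 * C) * (e x * indicator (\<Omega> - ball 0 (R - 1)) x) \<partial>lebesgue)" .
  then show ?thesis
    unfolding energy_eq[OF has_weak_gradient_subset[OF G \<Omega>(3)] \<Omega>(1)] unfolding e_def \<Omega>_def .
qed

text \<open>
  The sequence \<open>\<theta>\<^sup>m b\<^sub>m\<close> increases, yet it tends to \<open>0\<close>.  For that limit \<open>\<theta>\<close> is written as an \<open>n\<close>-th
  power, which reduces the polynomial factor to the case of degree one.
\<close>

lemma geometric_vs_polynomial_growth:
  fixes b :: "nat \<Rightarrow> real"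
  assumes \<theta>: "0 < \<theta>" "\<theta> < 1" and n: "n > 0" and b0: "\<And>k. 0 \<le> b k"
    and step: "\<And>k. b k \<le> \<theta> * b (Suc k)" and poly: "\<And>k. b k \<le> A * real k ^ n"
  shows "b k = 0"
proof -
  define d where "d m = \<theta> ^ m * b m" for m
  have inc: "incseq d"
    using \<theta> step by (intro incseq_SucI) (simp add: d_def mult.assoc mult_left_mono flip: power_Suc2)
  define q where "q = root n \<theta>"
  have q: "0 < q" "q < 1" "q ^ n = \<theta>" using \<theta> n by (auto simp: q_def)
  have "(\<lambda>m. A * (real m * q ^ m) ^ n) \<longlonglongrightarrow> A * 0 ^ n"
    using q by (intro tendsto_intros powser_times_n_limit_0) auto
  then have lim: "(\<lambda>m. A * (real m * q ^ m) ^ n) \<longlonglongrightarrow> 0" by (simp only: zero_power[OF n] mult_zero_right)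
  have "d \<longlonglongrightarrow> 0"
  proof (rule tendsto_sandwich[OF _ _ tendsto_const lim])
    show "\<forall>\<^sub>F m in sequentially. 0 \<le> d m" using \<theta> b0 by (simp add: d_def)
    have "d m \<le> A * (real m * q ^ m) ^ n" for m
    proof -
      have "d m \<le> \<theta> ^ m * (A * real m ^ n)"
        unfolding d_def using \<theta> poly by (intro mult_left_mono) auto
      also have "\<theta> ^ m = (q ^ m) ^ n" by (simp flip: q(3) power_mult add: mult.commute)
      finally show ?thesis by (simp add: power_mult_distrib mult_ac)
    qed
    then show "\<forall>\<^sub>F m in sequentially. d m \<le> A * (real m * q ^ m) ^ n" by simp
  qed
  then have "d k \<le> 0" by (rule incseq_le[OF inc])
  then have "b k \<le> 0" using \<theta> zero_less_power[OF \<theta>(1), of k] unfolding d_def by (simp add: mult_le_0_iff)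
  then show ?thesis using b0[of k] by simp
qed

theorem theorem3p2:
  fixes W :: "real^'m \<Rightarrow> real" and a :: "real^'m" and u :: "real^'n \<Rightarrow> real^'m"
    and Z :: "(real^'m) set"
  assumes HA: "HA W a"
    and HB: "HB W a UNIV u"
    and Z: "Z = {z. W z = 0} - {a}"
    and sep: "Z = {} \<or> (\<exists>\<delta>>0. AE x in lebesgue. infdist (u x) Z \<ge> \<delta>)"
  shows "(AE x in lebesgue. u x = a) \<and> (continuous_on UNIV u \<longrightarrow> (\<forall>x. u x = a))"
proof -
  have W: "\<And>z. 0 \<le> W z" "W a = 0" using HA by (auto simp: HA_def)
  define G where "G = weak_gradient UNIV u"
  have G: "has_weak_gradient UNIV u G"
    using HB unfolding HB_def W12_loc_def G_def weak_gradient_def by (metis someI_ex)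
  have min: "minimal_map W UNIV u" using HB by (simp add: HB_def)
  obtain M where M: "M > 0" "AE x in lebesgue. norm (u x - a) < M" "AE x in lebesgue. norm (G x) < M"
    using HB unfolding HB_def lebesgue_on_UNIV_eq G_def by blast
  have uM: "AE x in lebesgue. norm (u x - a) \<le> M" and GM: "AE x in lebesgue. norm (G x) \<le> M"
    using M by (auto elim: eventually_mono)
  obtain \<delta> where \<delta>: "\<delta> > 0" "Z = {} \<or> (AE x in lebesgue. infdist (u x) Z \<ge> \<delta>)"
    using sep zero_less_one by metis
  \<comment> \<open>A compact set that contains almost all values of \<open>u\<close> and no zero of \<open>W\<close> other than \<open>a\<close>.\<close>
  define K where "K = cball a M \<inter> {z. Z = {} \<or> infdist z Z \<ge> \<delta>}"
  have "closed {z. Z = {} \<or> infdist z Z \<ge> \<delta>}"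
    by (cases "Z = {}") (auto intro!: closed_Collect_le continuous_intros)
  then have K: "compact K" unfolding K_def by (intro compact_Int_closed) auto
  have uK: "AE x in lebesgue. u x \<in> K"
  proof (cases "Z = {}")
    case True
    then show ?thesis using uM by (simp add: K_def dist_norm norm_minus_commute)
  next
    case False
    then have "AE x in lebesgue. infdist (u x) Z \<ge> \<delta>" using \<delta> by simp
    with uM show ?thesis
      by eventually_elim (simp add: K_def dist_norm norm_minus_commute)
  qed
  have zero: "z = a" if "z \<in> K" "W z = 0" for z
  proof (rule ccontr)
    assume "z \<noteq> a"
    then have "z \<in> Z" using that Z by simp
    then have "infdist z Z = 0" "Z \<noteq> {}" by auto
    then show False using that \<delta>(1) by (auto simp: K_def)
  qed
  obtain C where C: "C > 0" "\<And>z. z \<in> K \<Longrightarrow> (norm (z - a))\<^sup>2 \<le> C * W z"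
    "\<And>z t. z \<in> K \<Longrightarrow> 0 \<le> t \<Longrightarrow> t \<le> 1 \<Longrightarrow> W (a + t *\<^sub>R (z - a)) \<le> C * W z"
    using potential_controls[OF HA K zero] by blast
  have quad: "AE x in lebesgue. (norm (u x - a))\<^sup>2 \<le> C * W (u x)"
    using uK by (rule eventually_mono) (rule C(2))
  have seg: "AE x in lebesgue. \<forall>t. 0 \<le> t \<and> t \<le> 1 \<longrightarrow> W (a + t *\<^sub>R (u x - a)) \<le> C * W (u x)"
    using uK by (rule eventually_mono) (use C(3) in blast)
  define e where "e x = ennreal (1/2 * (norm (G x))\<^sup>2 + W (u x))" for x
  \<comment> \<open>The energy of \<open>u\<close> in the ball of radius \<open>r\<close>.\<close>
  define I where "I r = (\<integral>\<^sup>+x. e x * indicator (ball 0 r) x \<partial>lebesgue)" for r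
  have L1: "L1_loc UNIV u" "L1_loc UNIV G" using G by (simp_all add: has_weak_gradient_def)
  have Wm: "W \<in> borel_measurable borel"
    using HA_continuous[OF HA] by (rule borel_measurable_continuous_onI)
  have em: "e \<in> borel_measurable lebesgue"
    unfolding e_def using borel_measurable_L1_loc[OF L1(2)] measurable_compose[OF borel_measurable_L1_loc[OF L1(1)] Wm]
    by measurable
  have bm: "ball (0::real^'n) r \<in> sets lebesgue" for r by simp
  have em': "(\<lambda>x. e x * indicator S x) \<in> borel_measurable lebesgue" if "S \<in> sets lebesgue" for S
    using em that by measurable
  have "bounded (W ` cball a M)"
    by (intro compact_imp_bounded compact_continuous_image) (auto intro: continuous_on_subset[OF HA_continuous[OF HA]])
  then obtain B where "\<forall>y\<in>W ` cball a M. norm y \<le> B" unfolding bounded_iff by blast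
  from bspec[OF this imageI] have B: "W z \<le> B" if "z \<in> cball a M" for z
    using that abs_ge_self[of "W z"] by (metis order_trans real_norm_def)
  define E where "E = M\<^sup>2 + B"
  have E0: "E \<ge> 0" using B[of a] W M by (simp add: E_def)
  have eE: "AE x in lebesgue. e x \<le> ennreal E"
    using uM GM
  proof eventually_elim
    case (elim x)
    have "(norm (G x))\<^sup>2 \<le> M\<^sup>2" using elim by (intro power_mono) auto
    moreover have "W (u x) \<le> B" using elim by (intro B) (simp add: dist_norm norm_minus_commute)
    moreover have "(norm (G x))\<^sup>2 \<ge> 0" by simp
    ultimately show ?case unfolding e_def E_def by (intro ennreal_leI) linarith
  qed
  have I_le: "I r \<le> ennreal (E * (unit_ball_vol (real CARD('n)) * r ^ CARD('n)))" if "r \<ge> 0" for r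
  proof -
    have "I r \<le> (\<integral>\<^sup>+x. ennreal E * indicator (ball 0 r) x \<partial>(lebesgue::(real^'n) measure))"
      unfolding I_def
      by (rule nn_integral_mono_AE, rule AE_mp[OF eE], rule AE_I2) (auto intro!: mult_right_mono)
    also have "\<dots> = ennreal E * emeasure lebesgue (ball (0::real^'n) r)"
      by (rule nn_integral_cmult_indicator[OF bm])
    also have "\<dots> = ennreal (E * (unit_ball_vol (real CARD('n)) * r ^ CARD('n)))"
      using emeasure_ball[OF that, of "0::real^'n"] E0 that by (simp add: ennreal_mult)
    finally show ?thesis .
  qed
  have fin: "I r < top" for r
  proof (cases "r \<ge> 0")
    case True
    then show ?thesis using I_le[OF True] by (rule_tac le_less_trans) auto
  next
    case False
    then show ?thesis by (simp add: I_def ball_empty)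
  qed
  \<comment> \<open>The shell energy is the difference of two ball energies; substituting it fills the hole.\<close>
  have step: "enn2real (I (R - 1)) * (2 + 65 * C) \<le> (1 + 65 * C) * enn2real (I (R + 1))" if R: "R \<ge> 1" for R
  proof -
    define J where "J = (\<integral>\<^sup>+x. e x * indicator (ball 0 (R + 1) - ball 0 (R - 1)) x \<partial>lebesgue)"
    have dm: "ball (0::real^'n) (R + 1) - ball 0 (R - 1) \<in> sets lebesgue" using bm by blast
    have "I (R + 1) = (\<integral>\<^sup>+x. e x * indicator (ball 0 (R - 1)) x + e x * indicator (ball 0 (R + 1) - ball 0 (R - 1)) x \<partial>lebesgue)"
      unfolding I_def by (rule nn_integral_cong) (auto simp: indicator_def)
    also have "\<dots> = I (R - 1) + J"
      unfolding I_def J_def by (rule nn_integral_add[OF em'[OF bm] em'[OF dm]])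
    finally have sum: "I (R + 1) = I (R - 1) + J" .
    then have Jfin: "J < top" using fin[of "R + 1"] by simp
    have "I (R + 1) \<le> (\<integral>\<^sup>+x. ennreal (2 + 65 * C) * (e x * indicator (ball 0 (R + 1) - ball 0 (R - 1)) x) \<partial>lebesgue)"
      unfolding I_def e_def
      by (rule minimal_hole_filling[OF min G uM GM W C(1) quad seg R])
    also have "\<dots> = ennreal (2 + 65 * C) * J"
      unfolding J_def by (rule nn_integral_cmult[OF em'[OF dm]])
    finally have "I (R + 1) \<le> ennreal (2 + 65 * C) * J" .
    then have "enn2real (I (R + 1)) \<le> enn2real (ennreal (2 + 65 * C) * J)"
      using Jfin by (intro enn2real_mono) (auto simp: ennreal_mult_less_top)
    also have "\<dots> = (2 + 65 * C) * enn2real J"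
      using C(1) by (simp add: enn2real_mult)
    also have "enn2real J = enn2real (I (R + 1)) - enn2real (I (R - 1))"
      unfolding sum using fin[of "R - 1"] Jfin by (simp add: enn2real_plus)
    finally show ?thesis by (simp add: algebra_simps)
  qed
  define \<theta> where "\<theta> = (1 + 65 * C) / (2 + 65 * C)"
  \<comment> \<open>Each step enlarges the radius from \<open>R - 1\<close> to \<open>R + 1\<close>, hence even radii.\<close>
  have I0: "I (2 * real k) = 0" for k
  proof -
    have "enn2real (I (2 * real k)) = 0"
    proof (rule geometric_vs_polynomial_growth[where \<theta> = \<theta> and b = "\<lambda>k. enn2real (I (2 * real k))"
          and n = "CARD('n)" and A = "E * (unit_ball_vol (real CARD('n)) * 2 ^ CARD('n))"])
      show "0 < \<theta>" "\<theta> < 1" using C(1) by (auto simp: \<theta>_def)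
      show "enn2real (I (2 * real k)) \<le> \<theta> * enn2real (I (2 * real (Suc k)))" for k
        using step[of "2 * real k + 1"] C(1) by (simp add: \<theta>_def field_simps)
      show "enn2real (I (2 * real k)) \<le> E * (unit_ball_vol (real CARD('n)) * 2 ^ CARD('n)) * real k ^ CARD('n)" for k
      proof -
        have "enn2real (I (2 * real k)) \<le> enn2real (ennreal (E * (unit_ball_vol (real CARD('n)) * (2 * real k) ^ CARD('n))))"
          by (intro enn2real_mono I_le) auto
        also have "\<dots> = E * (unit_ball_vol (real CARD('n)) * (2 * real k) ^ CARD('n))"
          using E0 by (intro enn2real_ennreal mult_nonneg_nonneg) auto
        finally show ?thesis by (simp add: power_mult_distrib mult_ac)
      qed
    qed auto
    then show ?thesis using fin[of "2 * real k"] by (auto simp: enn2real_eq_0_iff)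
  qed
  have "AE x in lebesgue. e x * indicator (ball 0 (2 * real k)) x = 0" for k
    using I0[of k] unfolding I_def nn_integral_0_iff_AE[OF em'[OF bm]] .
  then have "AE x in lebesgue. \<forall>k::nat. e x * indicator (ball 0 (2 * real k)) x = 0"
    by (simp only: AE_all_countable) blast
  then have main: "AE x in lebesgue. u x = a"
    using uK
  proof eventually_elim
    case (elim x)
    obtain k where "norm x < real k" using reals_Archimedean2 by blast
    then have "x \<in> ball 0 (2 * real k)" by auto
    then have "e x = 0" using elim(1)[rule_format, of k] by simp
    then have "1/2 * (norm (G x))\<^sup>2 + W (u x) \<le> 0" by (simp add: e_def ennreal_eq_0_iff)
    then have "W (u x) = 0" using W(1)[of "u x"] zero_le_power2[of "norm (G x)"] by linarith
    then show ?case using zero elim(2) by blast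
  qed
  moreover have "\<forall>x. u x = a" if cont: "continuous_on UNIV u"
  proof -
    have "open {x. u x \<noteq> a}"
      using cont by (intro open_Collect_neq continuous_on_const)
    moreover have "{x. u x \<noteq> a} \<in> null_sets lebesgue"
      using main AE_iff_null_sets[of "{x. u x \<noteq> a}" lebesgue] \<open>open {x. u x \<noteq> a}\<close> by simp
    ultimately have "{x. u x \<noteq> a} = {}"
      using open_not_negligible negligible_iff_null_sets by blast
    then show ?thesis by blast
  qed
  ultimately show ?thesis by blast
qed

end
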